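(* Let $\mathbb{G}_1$ and $\mathbb{G}_2$ be two Carnot groups possessing non-zero non-abnormal horizontal directions. Then the Carnot group $\mathbb{G}_1\times\mathbb{G}_2$ possesses a non-zero non-abnormal horizontal direction.
   Context: A Carnot group $\mathbb{G}$ of step $s$ is a connected, simply connected Lie group whose Lie algebra $\mathfrak{g}$ is stratified: $\mathfrak{g}=\mathfrak{g}_1\oplus\dots\oplus\mathfrak{g}_s$ with $[\mathfrak{g}_1,\mathfrak{g}_i]=\mathfrak{g}_{i+1}$ for $1\le i\le s-1$, $\mathfrak{g}_s\ne\{0\}$, $[\mathfrak{g}_1,\mathfrak{g}_s]=\{0\}$. Horizontal directions are elements of $\mathfrak{g}_1$. The product $\mathbb{G}_1\times\mathbb{G}_2$ is a Carnot group whose horizontal layer is the product of the horizontal layers of the two Lie algebras. The end-point map $\mathrm{End}:L^\infty([0,1];\mathfrak{g}_1)\to\mathbb{G}$ is $\mathrm{End}(h)=\gamma(1)$, where $\gamma$ is the unique solution of $\dot\gamma(t)=h(t)$ (with $h(t)$ viewed as a left-invariant vector field evaluated at $\gamma(t)$), $\gamma(0)=0$ (the identity). A horizontal curve $\gamma:[0,1]\to\mathbb{G}$ is non-abnormal if the differential of $\mathrm{End}$ at the control of $\gamma$ has full rank (is surjective). A direction $X\in\mathfrak{g}_1\setminus\{0\}$ is non-abnormal if the curve $t\mapsto\exp(tX)$, $t\in[0,1]$, is non-abnormal. *)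

theory Defs
  imports "HOL-Analysis.Analysis" "HOL-Probability.Essential_Supremum"
begin

section \<open>Smooth maps and manifolds\<close>

text \<open>Intended for open \<open>S\<close>: the iterated directional derivatives up to order \<open>k\<close>
  exist and are continuous on \<open>S\<close>.\<close>

fun Ck_on :: "nat \<Rightarrow> 'a::euclidean_space set \<Rightarrow> ('a \<Rightarrow> 'b::euclidean_space) \<Rightarrow> bool" where
  "Ck_on 0 S f \<longleftrightarrow> continuous_on S f"
| "Ck_on (Suc k) S f \<longleftrightarrow>
     (\<forall>x\<in>S. f differentiable (at x)) \<and>
     (\<forall>v. Ck_on k S (\<lambda>x. frechet_derivative f (at x) v))"

definition smooth_on :: "'a::euclidean_space set \<Rightarrow> ('a \<Rightarrow> 'b::euclidean_space) \<Rightarrow> bool" where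
  "smooth_on S f \<longleftrightarrow> (\<forall>k. Ck_on k S f)"

text \<open>A chart maps its domain \<open>cdom\<close> homeomorphically onto an open set by \<open>cmap\<close>,
  with inverse \<open>cinv\<close>.  The values of \<open>cmap\<close> off \<open>cdom\<close>, and of \<open>cinv\<close> off
  the image, are irrelevant.\<close>

record ('g, 'e) chart =
  cdom :: "'g set"
  cmap :: "'g \<Rightarrow> 'e"
  cinv :: "'e \<Rightarrow> 'g"

definition smooth_atlas ::
    "('g::topological_space, 'e::euclidean_space) chart set \<Rightarrow> bool" where
  "smooth_atlas A \<longleftrightarrow>
     (\<forall>c\<in>A. open (cdom c) \<and> open (cmap c ` cdom c) \<and>
        homeomorphism (cdom c) (cmap c ` cdom c) (cmap c) (cinv c)) \<and>
     (\<Union>c\<in>A. cdom c) = UNIV \<and>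
     (\<forall>c\<in>A. \<forall>d\<in>A. smooth_on (cmap c ` (cdom c \<inter> cdom d)) (cmap d \<circ> cinv c))"

definition smooth_map ::
    "('g::topological_space, 'e::euclidean_space) chart set \<Rightarrow>
     ('h::topological_space, 'f::euclidean_space) chart set \<Rightarrow> ('g \<Rightarrow> 'h) \<Rightarrow> bool" where
  "smooth_map A B f \<longleftrightarrow> continuous_on UNIV f \<and>
     (\<forall>c\<in>A. \<forall>d\<in>B. smooth_on (cmap c ` (cdom c \<inter> f -` cdom d)) (cmap d \<circ> f \<circ> cinv c))"

definition prod_chart :: "('g, 'e) chart \<Rightarrow> ('h, 'f) chart \<Rightarrow> ('g \<times> 'h, 'e \<times> 'f) chart" where
  "prod_chart c d = \<lparr> cdom = cdom c \<times> cdom d,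
     cmap = map_prod (cmap c) (cmap d), cinv = map_prod (cinv c) (cinv d) \<rparr>"

definition prod_atlas ::
    "('g, 'e) chart set \<Rightarrow> ('h, 'f) chart set \<Rightarrow> ('g \<times> 'h, 'e \<times> 'f) chart set" where
  "prod_atlas A B = {prod_chart c d | c d. c \<in> A \<and> d \<in> B}"


section \<open>Lie groups and Carnot groups\<close>

text \<open>The (in general noncommutative) group law is the operation \<open>+\<close> of class
  \<open>group_add\<close>, with identity \<open>0\<close>.  The tangent space at the identity is identified with the
  model space \<open>'e\<close> by the derivative of \<open>id_chart\<close>; so the elements of the Lie algebra
  are the vectors of \<open>'e\<close>.  The layer \<open>i\<close> of the stratification is \<open>layer G i\<close>,
  for \<open>1 \<le> i \<le> step G\<close>.\<close>

record ('g, 'e) stratified_group =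
  atlas :: "('g, 'e) chart set"
  id_chart :: "('g, 'e) chart"
  layer :: "nat \<Rightarrow> 'e set"
  step :: nat

definition lie_group ::
    "('g::{t2_space, second_countable_topology, group_add}, 'e::euclidean_space)
       stratified_group \<Rightarrow> bool" where
  "lie_group G \<longleftrightarrow>
     smooth_atlas (atlas G) \<and> id_chart G \<in> atlas G \<and> 0 \<in> cdom (id_chart G) \<and>
     smooth_map (prod_atlas (atlas G) (atlas G)) (atlas G) (\<lambda>(p, q). p + q) \<and>
     smooth_map (atlas G) (atlas G) uminus"

definition id_coord :: "('g::group_add, 'e) stratified_group \<Rightarrow> 'e" where
  "id_coord G = cmap (id_chart G) 0"

text \<open>The left-invariant vector field with value \<open>X\<close> at the identity, evaluated at \<open>p\<close> and
  expressed in the chart \<open>c\<close> around \<open>p\<close>: the differential at the identity of the left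
  translation by \<open>p\<close>, applied to \<open>X\<close>.\<close>

definition left_invariant_field ::
    "('g::group_add, 'e::euclidean_space) stratified_group \<Rightarrow> ('g, 'e) chart \<Rightarrow> 'e \<Rightarrow> 'g \<Rightarrow> 'e" where
  "left_invariant_field G c X p =
     frechet_derivative (\<lambda>x. cmap c (p + cinv (id_chart G) x)) (at (id_coord G)) X"

text \<open>The value at the identity of the commutator of the two left-invariant vector fields, by
  the coordinate formula \<open>[X, Y] = DY X - DX Y\<close>.\<close>

definition lie_bracket ::
    "('g::group_add, 'e::euclidean_space) stratified_group \<Rightarrow> 'e \<Rightarrow> 'e \<Rightarrow> 'e" where
  "lie_bracket G X Y =
     (let field = (\<lambda>Z x. left_invariant_field G (id_chart G) Z (cinv (id_chart G) x))
      in frechet_derivative (field Y) (at (id_coord G)) X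
       - frechet_derivative (field X) (at (id_coord G)) Y)"

definition bracket_span ::
    "('g::group_add, 'e::euclidean_space) stratified_group \<Rightarrow> 'e set \<Rightarrow> 'e set \<Rightarrow> 'e set" where
  "bracket_span G V W = span {lie_bracket G X Y | X Y. X \<in> V \<and> Y \<in> W}"

definition stratification :: "('g::group_add, 'e::euclidean_space) stratified_group \<Rightarrow> bool" where
  "stratification G \<longleftrightarrow>
     1 \<le> step G \<and>
     (\<forall>i. subspace (layer G i)) \<and>
     (\<forall>i. i \<notin> {1..step G} \<longrightarrow> layer G i = {0}) \<and>
     (\<forall>X. \<exists>!f. (\<forall>i. f i \<in> layer G i) \<and> X = (\<Sum>i = 1..step G. f i)) \<and>
     (\<forall>i. 1 \<le> i \<and> i < step G \<longrightarrow>
        bracket_span G (layer G 1) (layer G i) = layer G (i + 1)) \<and>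
     layer G (step G) \<noteq> {0} \<and>
     bracket_span G (layer G 1) (layer G (step G)) = {0}"

definition carnot_group ::
    "('g::{t2_space, second_countable_topology, group_add}, 'e::euclidean_space)
       stratified_group \<Rightarrow> bool" where
  "carnot_group G \<longleftrightarrow>
     lie_group G \<and> connected (UNIV :: 'g set) \<and> simply_connected (UNIV :: 'g set) \<and>
     stratification G"

text \<open>The group law and the topology of the direct product are those of the product type.\<close>

definition carnot_prod ::
    "('g, 'e) stratified_group \<Rightarrow> ('h, 'f) stratified_group \<Rightarrow>
     ('g \<times> 'h, 'e \<times> 'f) stratified_group" where
  "carnot_prod G H =
     \<lparr> atlas = prod_atlas (atlas G) (atlas H),
       id_chart = prod_chart (id_chart G) (id_chart H),
       layer = (\<lambda>i. layer G i \<times> layer H i),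
       step = max (step G) (step H) \<rparr>"


section \<open>The end-point map\<close>

definition Linf_norm :: "(real \<Rightarrow> 'e::euclidean_space) \<Rightarrow> real" where
  "Linf_norm h = real_of_ereal (esssup (lebesgue_on {0..1}) (\<lambda>t. ereal (norm (h t))))"

text \<open>The space \<open>L\<^sup>\<infinity>([0,1]; V\<^sub>1)\<close>, with functions in place of classes modulo null sets.\<close>

definition controls :: "('g, 'e::euclidean_space) stratified_group \<Rightarrow> (real \<Rightarrow> 'e) set" where
  "controls G = {h. h \<in> borel_measurable (lebesgue_on {0..1}) \<and>
     (AE t in lebesgue_on {0..1}. h t \<in> layer G 1) \<and>
     esssup (lebesgue_on {0..1}) (\<lambda>t. ereal (norm (h t))) < \<infinity>}"

text \<open>\<open>\<gamma>\<close> is an (absolutely continuous) solution of \<open>\<gamma>' = h\<close> almost everywhere with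
  \<open>\<gamma> 0 = 0\<close>, written as an integral equation in each chart.\<close>

definition has_control ::
    "('g::{topological_space, group_add}, 'e::euclidean_space) stratified_group \<Rightarrow>
     (real \<Rightarrow> 'g) \<Rightarrow> (real \<Rightarrow> 'e) \<Rightarrow> bool" where
  "has_control G \<gamma> h \<longleftrightarrow>
     continuous_on {0..1} \<gamma> \<and> \<gamma> 0 = 0 \<and>
     (\<forall>c\<in>atlas G. \<forall>a b. 0 \<le> a \<and> a \<le> b \<and> b \<le> 1 \<and> \<gamma> ` {a..b} \<subseteq> cdom c \<longrightarrow>
        (\<lambda>t. left_invariant_field G c (h t) (\<gamma> t)) absolutely_integrable_on {a..b} \<and>
        cmap c (\<gamma> b) = cmap c (\<gamma> a)
          + integral {a..b} (\<lambda>t. left_invariant_field G c (h t) (\<gamma> t)))"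

text \<open>\<open>E\<close> is the end-point map: \<open>E h = \<gamma> 1\<close> for the unique \<open>\<gamma>\<close> with control \<open>h\<close>.
  On \<open>controls G\<close> this determines \<open>E\<close>; that such an \<open>E\<close> exists on every Lie group is the
  well-posedness of the differential equation.\<close>

definition endpoint_map ::
    "('g::{topological_space, group_add}, 'e::euclidean_space) stratified_group \<Rightarrow>
     ((real \<Rightarrow> 'e) \<Rightarrow> 'g) \<Rightarrow> bool" where
  "endpoint_map G E \<longleftrightarrow>
     (\<forall>h\<in>controls G. \<exists>\<gamma>. has_control G \<gamma> h \<and>
        (\<forall>\<gamma>'. has_control G \<gamma>' h \<longrightarrow> (\<forall>t\<in>{0..1}. \<gamma>' t = \<gamma> t)) \<and>
        E h = \<gamma> 1)"

definition bounded_linear_on_controls ::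
    "('g, 'e::euclidean_space) stratified_group \<Rightarrow> ((real \<Rightarrow> 'e) \<Rightarrow> 'e) \<Rightarrow> bool" where
  "bounded_linear_on_controls G T \<longleftrightarrow>
     (\<forall>u\<in>controls G. \<forall>v\<in>controls G. T (\<lambda>t. u t + v t) = T u + T v) \<and>
     (\<forall>r. \<forall>u\<in>controls G. T (\<lambda>t. r *\<^sub>R u t) = r *\<^sub>R T u) \<and>
     (\<exists>K. \<forall>u\<in>controls G. norm (T u) \<le> K * Linf_norm u)"

text \<open>\<open>T\<close> is the (Frechet) differential at \<open>u\<close> of the end-point map, where the chart \<open>c\<close>
  identifies the tangent space of the group at the end-point of \<open>u\<close> with \<open>'e\<close>.\<close>

definition has_endpoint_differential ::
    "('g::{topological_space, group_add}, 'e::euclidean_space) stratified_group \<Rightarrow>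
     ('g, 'e) chart \<Rightarrow> (real \<Rightarrow> 'e) \<Rightarrow> ((real \<Rightarrow> 'e) \<Rightarrow> 'e) \<Rightarrow> bool" where
  "has_endpoint_differential G c u T \<longleftrightarrow>
     bounded_linear_on_controls G T \<and>
     (\<exists>E. endpoint_map G E \<and> E u \<in> cdom c \<and>
       (\<forall>\<epsilon>>0. \<exists>\<delta>>0. \<forall>v\<in>controls G. Linf_norm v < \<delta> \<longrightarrow>
          E (\<lambda>t. u t + v t) \<in> cdom c \<and>
          norm (cmap c (E (\<lambda>t. u t + v t)) - cmap c (E u) - T v) \<le> \<epsilon> * Linf_norm v))"


section \<open>Non-abnormal curves and directions\<close>

text \<open>Surjectivity of the differential does not depend on the chart around the end-point.\<close>

definition non_abnormal_curve ::
    "('g::{topological_space, group_add}, 'e::euclidean_space) stratified_group \<Rightarrow>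
     (real \<Rightarrow> 'g) \<Rightarrow> bool" where
  "non_abnormal_curve G \<gamma> \<longleftrightarrow>
     (\<exists>h\<in>controls G. has_control G \<gamma> h \<and>
       (\<exists>c\<in>atlas G. \<exists>T. has_endpoint_differential G c h T \<and> T ` controls G = UNIV))"

text \<open>\<open>\<sigma>\<close> is the curve \<open>t \<mapsto> exp (tX)\<close>.\<close>

definition one_parameter_subgroup ::
    "('g::{topological_space, group_add}, 'e::euclidean_space) stratified_group \<Rightarrow>
     'e \<Rightarrow> (real \<Rightarrow> 'g) \<Rightarrow> bool" where
  "one_parameter_subgroup G X \<sigma> \<longleftrightarrow>
     continuous_on UNIV \<sigma> \<and> (\<forall>s t. \<sigma> (s + t) = \<sigma> s + \<sigma> t) \<and>
     ((\<lambda>t. cmap (id_chart G) (\<sigma> t)) has_vector_derivative X) (at 0)"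

definition non_abnormal_direction ::
    "('g::{topological_space, group_add}, 'e::euclidean_space) stratified_group \<Rightarrow> 'e \<Rightarrow> bool" where
  "non_abnormal_direction G X \<longleftrightarrow>
     X \<in> layer G 1 \<and> X \<noteq> 0 \<and>
     (\<exists>\<sigma>. one_parameter_subgroup G X \<sigma> \<and> non_abnormal_curve G \<sigma>)"

end

theory Submission
  imports Defs
begin

text \<open>Everything is componentwise.  The left-invariant fields of the product, hence its brackets, are
  pairs, and bracketing with \<open>0\<close> in one factor separates the two stratifications.  A curve in the
  product has control \<open>(h, k)\<close> iff its components have controls \<open>h\<close> and \<open>k\<close>, so the end-point map of
  the product is \<open>(h, k) \<mapsto> (E h, F k)\<close> and its differential is the product of the differentials of
  \<open>E\<close> and \<open>F\<close>, which is surjective when both are.  Thus \<open>(X, Y)\<close> is non-abnormal if \<open>X\<close> and \<open>Y\<close>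
  are.\<close>

section \<open>Calculus of smooth maps\<close>

text \<open>The obstacle is that \<open>frechet_derivative\<close> is a choice operator: where a map
  is not differentiable its value is arbitrary and need not respect pairs. So a field of the product
  is identified with a pair of fields only at points inside the chart in use, where the joint
  smoothness of the group law supplies differentiability, and such an identity is differentiated
  again only on an open neighbourhood of the identity. The two factors may also have different
  steps; the conditions on each stratification are therefore extended past its own step, where all
  layers are trivial. Existence and uniqueness of solutions enter through the maps \<open>E\<close>
  and \<open>F\<close> that accompany the two given differentials, so no differential equation is
  solved here.\<close>

lemma Ck_on_subset: "Ck_on k S f \<Longrightarrow> T \<subseteq> S \<Longrightarrow> Ck_on k T f"
  by (induction k arbitrary: f) (auto intro: continuous_on_subset)

text \<open>A derivative depends only on the values near the point, so on an open set equality of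
  functions passes to all iterated derivatives. This is what allows
  \<open>frechet_derivative\<close> of a compound expression to be replaced by an explicit
  formula.\<close>

lemma Ck_on_cong:
  assumes "open S" "\<And>x. x \<in> S \<Longrightarrow> f x = g x" "Ck_on k S f"
  shows "Ck_on k S g"
  using assms(2,3)
proof (induction k arbitrary: f g)
  case 0
  then show ?case using continuous_on_cong[of S S f g] by simp
next
  case (Suc k)
  have "g differentiable (at x)" if x: "x \<in> S" for x
  proof -
    obtain f' where "(f has_derivative f') (at x)"
      using Suc.prems x by (auto simp: differentiable_def)
    then have "(g has_derivative f') (at x)"
      using Suc.prems(1) by (rule has_derivative_transform_within_open[OF _ assms(1) x])
    then show ?thesis by (auto simp: differentiable_def)
  qed
  moreover have "Ck_on k S (\<lambda>x. frechet_derivative g (at x) v)" for v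
  proof (rule Suc.IH)
    show "Ck_on k S (\<lambda>x. frechet_derivative f (at x) v)"
      using Suc.prems by simp
    show "frechet_derivative f (at x) v = frechet_derivative g (at x) v" if "x \<in> S" for x
      using frechet_derivative_transform_within_open[of f x S g] Suc.prems that assms(1) by simp
  qed
  ultimately show ?case by simp
qed

text \<open>The derivative of \<open>L\<close> is constant, so the derivative of the composite in
  direction \<open>v\<close> is the derivative of \<open>f\<close> in the fixed direction
  \<open>L v\<close>, again composed with \<open>L\<close>. The induction thus closes without a
  higher-order chain rule.\<close>

lemma Ck_on_compose_linear:
  fixes L :: "'c::euclidean_space \<Rightarrow> 'a::euclidean_space"
  assumes "linear L" "open S" "Ck_on k S f"
  shows "Ck_on k (L -` S) (\<lambda>x. f (L x))"
  using assms(3)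
proof (induction k arbitrary: f)
  case 0
  have "continuous_on (L -` S) L"
    by (simp add: assms(1) linear_continuous_on linear_conv_bounded_linear[symmetric])
  then show ?case using 0 by (auto intro: continuous_on_compose2)
next
  case (Suc k)
  have L: "(L has_derivative L) (at x)" for x
    using assms(1) by (simp add: linear_conv_bounded_linear bounded_linear_imp_has_derivative)
  have op: "open (L -` S)"
    using assms(1,2) by (metis continuous_open_vimage linear_conv_bounded_linear linear_continuous_at)
  have D: "((\<lambda>x. f (L x)) has_derivative (\<lambda>v. frechet_derivative f (at (L x)) (L v))) (at x)"
    if "L x \<in> S" for x
    using Suc.prems that has_derivative_compose[OF L[of x], of f] by (simp add: frechet_derivative_works)
  have "Ck_on k (L -` S) (\<lambda>x. frechet_derivative (\<lambda>x. f (L x)) (at x) v)" for v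
  proof (rule Ck_on_cong[OF op])
    show "Ck_on k (L -` S) (\<lambda>x. frechet_derivative f (at (L x)) (L v))"
      using Suc.IH[of "\<lambda>x. frechet_derivative f (at x) (L v)"] Suc.prems by simp
  qed (use fun_cong[OF frechet_derivative_at[OF D]] in auto)
  then show ?case using D by (auto simp: differentiable_def)
qed

lemma Ck_on_Pair:
  assumes "open S" "Ck_on k S f" "Ck_on k S g"
  shows "Ck_on k S (\<lambda>x. (f x, g x))"
  using assms(2,3)
proof (induction k arbitrary: f g)
  case 0
  then show ?case by (simp add: continuous_on_Pair)
next
  case (Suc k)
  have D: "((\<lambda>x. (f x, g x)) has_derivative
      (\<lambda>v. (frechet_derivative f (at x) v, frechet_derivative g (at x) v))) (at x)"
    if "x \<in> S" for x
    using Suc.prems that by (auto simp: frechet_derivative_works intro: has_derivative_Pair)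
  have "Ck_on k S (\<lambda>x. frechet_derivative (\<lambda>x. (f x, g x)) (at x) v)" for v
  proof (rule Ck_on_cong[OF assms(1)])
    show "Ck_on k S (\<lambda>x. (frechet_derivative f (at x) v, frechet_derivative g (at x) v))"
      using Suc.IH Suc.prems by simp
  qed (use fun_cong[OF frechet_derivative_at[OF D]] in auto)
  then show ?case using D by (auto simp: differentiable_def)
qed

text \<open>Transition maps, inversion and multiplication of a product all have this form in
  coordinates, with \<open>L\<close> and \<open>M\<close> projections or regroupings of coordinates.
  The set \<open>U\<close> only has to lie in the open set on which the pair is smooth.\<close>

lemma smooth_on_Pair_linear:
  fixes L :: "'c::euclidean_space \<Rightarrow> 'a::euclidean_space" and M :: "'c \<Rightarrow> 'b::euclidean_space"
  assumes "linear L" "linear M" "open S" "open T" "smooth_on S f" "smooth_on T g"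
    and "U \<subseteq> L -` S \<inter> M -` T"
  shows "smooth_on U (\<lambda>x. (f (L x), g (M x)))"
proof -
  have op: "open (L -` S \<inter> M -` T)"
    using assms(1-4) by (intro open_Int)
      (metis continuous_open_vimage linear_conv_bounded_linear linear_continuous_at)+
  have "Ck_on k U (\<lambda>x. (f (L x), g (M x)))" for k
  proof (rule Ck_on_subset[OF Ck_on_Pair[OF op] assms(7)])
    show "Ck_on k (L -` S \<inter> M -` T) (\<lambda>x. f (L x))"
      by (rule Ck_on_subset[OF Ck_on_compose_linear[OF assms(1,3)]]) (use assms(5) in \<open>auto simp: smooth_on_def\<close>)
    show "Ck_on k (L -` S \<inter> M -` T) (\<lambda>x. g (M x))"
      by (rule Ck_on_subset[OF Ck_on_compose_linear[OF assms(2,4)]]) (use assms(6) in \<open>auto simp: smooth_on_def\<close>)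
  qed
  then show ?thesis by (simp add: smooth_on_def)
qed

lemma has_derivative_map_prod:
  assumes "(f has_derivative f') (at (fst z))" "(g has_derivative g') (at (snd z))"
  shows "(map_prod f g has_derivative map_prod f' g') (at z)"
proof -
  have "((\<lambda>x. (f (fst x), g (snd x))) has_derivative (\<lambda>x. (f' (fst x), g' (snd x)))) (at z)"
    by (intro has_derivative_Pair
        has_derivative_compose[OF has_derivative_fst[OF has_derivative_ident], of f]
        has_derivative_compose[OF has_derivative_snd[OF has_derivative_ident], of g] assms)
  then show ?thesis by (simp add: map_prod_def case_prod_unfold)
qed

text \<open>Differentiability of both components pins down the chosen derivatives, which are
  otherwise arbitrary; the later differentiability lemmas serve to discharge these two
  conditions.\<close>

lemma frechet_derivative_map_prod:
  assumes "f differentiable (at (fst z))" "g differentiable (at (snd z))"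
  shows "frechet_derivative (map_prod f g) (at z) =
    map_prod (frechet_derivative f (at (fst z))) (frechet_derivative g (at (snd z)))"
  using assms has_derivative_map_prod frechet_derivative_at frechet_derivative_works by metis


section \<open>Products of smooth atlases\<close>

lemma prod_chart_simps [simp]:
  "cdom (prod_chart c d) = cdom c \<times> cdom d"
  "cmap (prod_chart c d) = map_prod (cmap c) (cmap d)"
  "cinv (prod_chart c d) = map_prod (cinv c) (cinv d)"
  by (simp_all add: prod_chart_def)

lemma prod_atlasE:
  assumes "c \<in> prod_atlas A B"
  obtains a b where "c = prod_chart a b" "a \<in> A" "b \<in> B"
  using assms by (auto simp: prod_atlas_def)

lemma prod_atlasI: "a \<in> A \<Longrightarrow> b \<in> B \<Longrightarrow> prod_chart a b \<in> prod_atlas A B"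
  by (auto simp: prod_atlas_def)

lemma chart_inverse:
  assumes "smooth_atlas A" "c \<in> A" "p \<in> cdom c"
  shows "cinv c (cmap c p) = p"
  using assms by (auto simp: smooth_atlas_def homeomorphism_def)

lemma open_chart_image:
  assumes "smooth_atlas A" "c \<in> A" "open U"
  shows "open (cmap c ` (cdom c \<inter> U))"
proof -
  have h: "homeomorphism (cdom c) (cmap c ` cdom c) (cmap c) (cinv c)" "open (cmap c ` cdom c)"
    using assms by (auto simp: smooth_atlas_def)
  \<comment> \<open>The image under \<open>cmap c\<close> is rewritten as a preimage under the
    continuous inverse \<open>cinv c\<close>, relative to the open chart image.\<close>
  have "cmap c ` (cdom c \<inter> U) = cmap c ` cdom c \<inter> cinv c -` U"
    using h(1) by (force simp: homeomorphism_def)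
  then show ?thesis
    using continuous_open_preimage[OF _ h(2) assms(3), of "cinv c"] h(1)
    by (auto simp: homeomorphism_def)
qed

lemma homeomorphism_map_prod:
  assumes "homeomorphism S S' f f'" "homeomorphism T T' g g'"
  shows "homeomorphism (S \<times> T) (S' \<times> T') (map_prod f g) (map_prod f' g')"
proof -
  have c: "continuous_on (A \<times> B) (map_prod p q)" if "continuous_on A p" "continuous_on B q"
    for A :: "'x::topological_space set" and B :: "'y::topological_space set"
      and p :: "'x \<Rightarrow> 'u::topological_space" and q :: "'y \<Rightarrow> 'v::topological_space"
    unfolding map_prod_def case_prod_unfold using that
    by (intro continuous_on_Pair continuous_on_compose2[OF that(1)] continuous_on_compose2[OF that(2)])
      (auto intro!: continuous_intros)
  show ?thesis
    using assms unfolding homeomorphism_def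
    by (auto intro!: c simp: map_prod_surj_on)
qed

lemma smooth_atlas_prod:
  assumes A: "smooth_atlas A" and B: "smooth_atlas B"
  shows "smooth_atlas (prod_atlas A B)"
  unfolding smooth_atlas_def
proof (intro conjI ballI)
  fix c assume "c \<in> prod_atlas A B"
  then obtain a b where ab: "c = prod_chart a b" "a \<in> A" "b \<in> B" by (rule prod_atlasE)
  show "open (cdom c)" "open (cmap c ` cdom c)"
    "homeomorphism (cdom c) (cmap c ` cdom c) (cmap c) (cinv c)"
    using ab A B
    by (auto simp: smooth_atlas_def open_Times map_prod_surj_on[OF refl refl] homeomorphism_map_prod)
  fix c' assume "c' \<in> prod_atlas A B"
  then obtain a' b' where ab': "c' = prod_chart a' b'" "a' \<in> A" "b' \<in> B" by (rule prod_atlasE)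
  have "smooth_on (cmap c ` (cdom c \<inter> cdom c'))
      (\<lambda>x. ((cmap a' \<circ> cinv a) (fst x), (cmap b' \<circ> cinv b) (snd x)))"
  proof (rule smooth_on_Pair_linear[OF linear_fst linear_snd])
    show "open (cmap a ` (cdom a \<inter> cdom a'))" "open (cmap b ` (cdom b \<inter> cdom b'))"
      using A B ab ab' by (auto intro!: open_chart_image simp: smooth_atlas_def)
    show "smooth_on (cmap a ` (cdom a \<inter> cdom a')) (cmap a' \<circ> cinv a)"
      "smooth_on (cmap b ` (cdom b \<inter> cdom b')) (cmap b' \<circ> cinv b)"
      using A B ab ab' by (auto simp: smooth_atlas_def)
  qed (auto simp: ab ab')
  then show "smooth_on (cmap c ` (cdom c \<inter> cdom c')) (cmap c' \<circ> cinv c)"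
    by (simp add: ab ab' comp_def map_prod_def case_prod_unfold)
next
  have "\<exists>c\<in>prod_atlas A B. (p, q) \<in> cdom c" for p q
  proof -
    obtain a b where "a \<in> A" "p \<in> cdom a" "b \<in> B" "q \<in> cdom b"
      using A B unfolding smooth_atlas_def by blast
    then show ?thesis by (auto intro!: bexI[OF _ prod_atlasI])
  qed
  then show "(\<Union>c\<in>prod_atlas A B. cdom c) = UNIV" by auto
qed

text \<open>The linear maps \<open>L\<close>, \<open>M\<close> and their counterparts \<open>l\<close>, \<open>m\<close> on the manifolds
  are the two projections for the inversion, and the two regroupings
  \<open>((p, q), (p', q')) \<mapsto> (p, p')\<close> and \<open>(q, q')\<close> for the multiplication.\<close>

lemma smooth_map_Pair:
  assumes A: "smooth_atlas A" and B: "smooth_atlas B"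
    and f: "smooth_map A A' f" and g: "smooth_map B B' g"
    and A': "smooth_atlas A'" and B': "smooth_atlas B'"
    and L: "linear L" "linear M"
    and cont: "continuous_on UNIV l" "continuous_on UNIV m"
    and charts: "\<And>c. c \<in> C \<Longrightarrow> \<exists>a\<in>A. \<exists>b\<in>B.
        (\<forall>p\<in>cdom c. l p \<in> cdom a \<and> m p \<in> cdom b \<and>
          L (cmap c p) = cmap a (l p) \<and> M (cmap c p) = cmap b (m p)) \<and>
        (\<forall>x. l (cinv c x) = cinv a (L x) \<and> m (cinv c x) = cinv b (M x))"
  shows "smooth_map C (prod_atlas A' B') (\<lambda>p. (f (l p), g (m p)))"
  unfolding smooth_map_def
proof (intro conjI ballI)
  have cf: "continuous_on UNIV f" and cg: "continuous_on UNIV g"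
    using f g by (auto simp: smooth_map_def)
  show "continuous_on UNIV (\<lambda>p. (f (l p), g (m p)))"
    by (intro continuous_on_Pair continuous_on_compose2[OF cf] continuous_on_compose2[OF cg] cont) auto
  fix c d assume "c \<in> C" and "d \<in> prod_atlas A' B'"
  then obtain a' b' where d: "d = prod_chart a' b'" "a' \<in> A'" "b' \<in> B'" by (auto elim: prod_atlasE)
  obtain a b where ab: "a \<in> A" "b \<in> B"
    and dm: "\<And>p. p \<in> cdom c \<Longrightarrow> l p \<in> cdom a \<and> m p \<in> cdom b \<and>
          L (cmap c p) = cmap a (l p) \<and> M (cmap c p) = cmap b (m p)"
    and iv: "\<And>x. l (cinv c x) = cinv a (L x) \<and> m (cinv c x) = cinv b (M x)"
    using charts[OF \<open>c \<in> C\<close>] by blast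
  have "smooth_on (cmap c ` (cdom c \<inter> (\<lambda>p. (f (l p), g (m p))) -` cdom d))
      (\<lambda>x. ((cmap a' \<circ> f \<circ> cinv a) (L x), (cmap b' \<circ> g \<circ> cinv b) (M x)))"
  proof (rule smooth_on_Pair_linear[OF L])
    have "open (f -` cdom a')" "open (g -` cdom b')"
      using cf cg A' B' d by (auto intro!: open_vimage simp: smooth_atlas_def)
    then show "open (cmap a ` (cdom a \<inter> f -` cdom a'))" "open (cmap b ` (cdom b \<inter> g -` cdom b'))"
      using A B ab by (auto intro!: open_chart_image)
    show "smooth_on (cmap a ` (cdom a \<inter> f -` cdom a')) (cmap a' \<circ> f \<circ> cinv a)"
      "smooth_on (cmap b ` (cdom b \<inter> g -` cdom b')) (cmap b' \<circ> g \<circ> cinv b)"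
      using f g ab d by (auto simp: smooth_map_def)
  qed (use dm d in force)
  then show "smooth_on (cmap c ` (cdom c \<inter> (\<lambda>p. (f (l p), g (m p))) -` cdom d))
      (cmap d \<circ> (\<lambda>p. (f (l p), g (m p))) \<circ> cinv c)"
    by (simp add: d iv comp_def)
qed


section \<open>The product of two Lie groups\<close>

lemma carnot_prod_simps [simp]:
  "atlas (carnot_prod G H) = prod_atlas (atlas G) (atlas H)"
  "id_chart (carnot_prod G H) = prod_chart (id_chart G) (id_chart H)"
  "layer (carnot_prod G H) i = layer G i \<times> layer H i"
  "step (carnot_prod G H) = max (step G) (step H)"
  by (simp_all add: carnot_prod_def)

lemma id_coord_carnot_prod [simp]: "id_coord (carnot_prod G H) = (id_coord G, id_coord H)"
  by (simp add: id_coord_def zero_prod_def)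

lemma linear_regroup:
  "linear (\<lambda>z. (fst (fst z), fst (snd z)))" "linear (\<lambda>z. (snd (fst z), snd (snd z)))"
  by (auto intro!: linearI)

lemma lie_group_carnot_prod:
  assumes G: "lie_group G" and H: "lie_group H"
  shows "lie_group (carnot_prod G H)"
proof -
  have g: "smooth_atlas (atlas G)" "id_chart G \<in> atlas G" "0 \<in> cdom (id_chart G)"
     "smooth_map (prod_atlas (atlas G) (atlas G)) (atlas G) (\<lambda>(p, q). p + q)"
     "smooth_map (atlas G) (atlas G) uminus"
    using G by (auto simp: lie_group_def)
  have h: "smooth_atlas (atlas H)" "id_chart H \<in> atlas H" "0 \<in> cdom (id_chart H)"
     "smooth_map (prod_atlas (atlas H) (atlas H)) (atlas H) (\<lambda>(p, q). p + q)"
     "smooth_map (atlas H) (atlas H) uminus"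
    using H by (auto simp: lie_group_def)
  let ?P = "prod_atlas (atlas G) (atlas H)"
  have "smooth_map ?P ?P (\<lambda>p. (- fst p, - snd p))"
    by (rule smooth_map_Pair[OF g(1) h(1) g(5) h(5) g(1) h(1) linear_fst linear_snd])
      (fastforce intro!: continuous_intros elim!: prod_atlasE)+
  moreover have "smooth_map (prod_atlas ?P ?P) ?P
      (\<lambda>z. ((\<lambda>(p, q). p + q) (fst (fst z), fst (snd z)), (\<lambda>(p, q). p + q) (snd (fst z), snd (snd z))))"
  proof (rule smooth_map_Pair[OF smooth_atlas_prod[OF g(1) g(1)] smooth_atlas_prod[OF h(1) h(1)]
        g(4) h(4) g(1) h(1) linear_regroup])
    fix c assume "c \<in> prod_atlas ?P ?P"
    then obtain a b a' b' where c: "c = prod_chart (prod_chart a b) (prod_chart a' b')"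
      "a \<in> atlas G" "b \<in> atlas H" "a' \<in> atlas G" "b' \<in> atlas H"
      by (auto elim!: prod_atlasE)
    \<comment> \<open>A chart of the squared product is built from \<open>a\<close>,
      \<open>b\<close>, \<open>a'\<close>, \<open>b'\<close>; regrouping matches it with the chart
      from \<open>a\<close> and \<open>a'\<close> on the square of the first group and the one from
      \<open>b\<close> and \<open>b'\<close> on the square of the second.\<close>
    show "\<exists>u\<in>prod_atlas (atlas G) (atlas G). \<exists>v\<in>prod_atlas (atlas H) (atlas H).
        (\<forall>p\<in>cdom c. (fst (fst p), fst (snd p)) \<in> cdom u \<and> (snd (fst p), snd (snd p)) \<in> cdom v \<and>
          (fst (fst (cmap c p)), fst (snd (cmap c p))) = cmap u (fst (fst p), fst (snd p)) \<and>
          (snd (fst (cmap c p)), snd (snd (cmap c p))) = cmap v (snd (fst p), snd (snd p))) \<and>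
        (\<forall>x. (fst (fst (cinv c x)), fst (snd (cinv c x))) = cinv u (fst (fst x), fst (snd x)) \<and>
          (snd (fst (cinv c x)), snd (snd (cinv c x))) = cinv v (snd (fst x), snd (snd x)))"
      by (rule bexI[OF _ prod_atlasI[OF c(2,4)]], rule bexI[OF _ prod_atlasI[OF c(3,5)]])
        (auto simp: c)
  qed (auto intro!: continuous_intros)
  moreover have "(\<lambda>p :: 'a \<times> 'c. (- fst p, - snd p)) = uminus"
    by (auto simp: fun_eq_iff uminus_prod_def)
  moreover have "(\<lambda>z :: ('a \<times> 'c) \<times> ('a \<times> 'c). ((\<lambda>(p, q). p + q) (fst (fst z), fst (snd z)),
      (\<lambda>(p, q). p + q) (snd (fst z), snd (snd z)))) = (\<lambda>(p, q). p + q)"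
    by (auto simp: fun_eq_iff)
  ultimately show ?thesis
    using g h by (auto simp: lie_group_def smooth_atlas_prod prod_atlasI zero_prod_def)
qed

text \<open>Joint smoothness is the form required below: freezing the first variable gives left
  translations, while differentiating in the second and then moving the first gives the variation of
  left-invariant fields.\<close>

lemma lie_group_mult:
  assumes G: "lie_group G" and c: "c \<in> atlas G" "d \<in> atlas G" "e \<in> atlas G"
  defines "S \<equiv> map_prod (cmap c) (cmap d) ` {(p, q). p \<in> cdom c \<and> q \<in> cdom d \<and> p + q \<in> cdom e}"
  shows "open S" "smooth_on S (\<lambda>z. cmap e (cinv c (fst z) + cinv d (snd z)))"
proof -
  have g: "smooth_atlas (atlas G)" 
     "smooth_map (prod_atlas (atlas G) (atlas G)) (atlas G) (\<lambda>(p, q). p + q)"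
    using G by (auto simp: lie_group_def)
  have S: "S = cmap (prod_chart c d) ` (cdom (prod_chart c d) \<inter> (\<lambda>(p, q). p + q) -` cdom e)"
    unfolding S_def by auto
  have "open (cdom e)" "continuous_on UNIV (\<lambda>(p, q). p + q :: 'a)"
    using g c by (auto simp: smooth_atlas_def smooth_map_def)
  then show "open S"
    unfolding S by (intro open_chart_image[OF smooth_atlas_prod[OF g(1) g(1)] prod_atlasI[OF c(1,2)]] open_vimage)
  have "smooth_on S (cmap e \<circ> (\<lambda>(p, q). p + q) \<circ> cinv (prod_chart c d))"
    using g(2) prod_atlasI[OF c(1,2)] c(3) unfolding S smooth_map_def by blast
  then show "smooth_on S (\<lambda>z. cmap e (cinv c (fst z) + cinv d (snd z)))"
    by (simp add: comp_def case_prod_unfold)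
qed

section \<open>Differentiability of left translations and of left-invariant fields in
  coordinates\<close>

lemma smooth_on_imp_differentiable:
  "smooth_on S f \<Longrightarrow> x \<in> S \<Longrightarrow> f differentiable (at x)"
  unfolding smooth_on_def by (metis Ck_on.simps(2))

lemma smooth_on_frechet_derivative:
  "smooth_on S f \<Longrightarrow> smooth_on S (\<lambda>x. frechet_derivative f (at x) v)"
  unfolding smooth_on_def by (metis Ck_on.simps(2))

lemma left_translation_differentiable:
  assumes G: "lie_group G" and c: "c \<in> atlas G" "p \<in> cdom c"
  shows "(\<lambda>x. cmap c (p + cinv (id_chart G) x)) differentiable (at (id_coord G))"
proof -
  let ?F = "\<lambda>z. cmap c (cinv c (fst z) + cinv (id_chart G) (snd z))"
  have g: "smooth_atlas (atlas G)" "id_chart G \<in> atlas G" "0 \<in> cdom (id_chart G)"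
    using G by (auto simp: lie_group_def)
  \<comment> \<open>The chart \<open>c\<close> serves both around the factor \<open>p\<close> and
    around the product; the point is admissible because \<open>p + 0 = p\<close>.\<close>
  have "?F differentiable (at (cmap c p, id_coord G))"
    by (rule smooth_on_imp_differentiable[OF lie_group_mult(2)[OF G c(1) g(2) c(1)]])
      (use c g in \<open>force simp: id_coord_def image_iff\<close>)
  then have "(?F \<circ> (\<lambda>x. (cmap c p, x))) differentiable (at (id_coord G))"
    by (intro differentiable_chain_at) auto
  then show ?thesis by (simp add: comp_def chart_inverse[OF g(1) c])
qed

abbreviation coord_field :: "('g::group_add, 'e::euclidean_space) stratified_group \<Rightarrow> 'e \<Rightarrow> 'e \<Rightarrow> 'e" where
  "coord_field G Z x \<equiv> left_invariant_field G (id_chart G) Z (cinv (id_chart G) x)"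

text \<open>A left-invariant field is already a derivative of the group law, and the bracket
  differentiates it once more. In coordinates it is a partial derivative of the smooth
  multiplication, restricted to a slice through the identity, hence differentiable.\<close>

lemma coord_field_differentiable:
  assumes G: "lie_group G"
  shows "coord_field G Z differentiable (at (id_coord G))"
proof -
  let ?i = "id_chart G"
  let ?e = "id_coord G"
  let ?F = "\<lambda>z. cmap ?i (cinv ?i (fst z) + cinv ?i (snd z))"
  let ?S = "map_prod (cmap ?i) (cmap ?i) ` {(p, q). p \<in> cdom ?i \<and> q \<in> cdom ?i \<and> p + q \<in> cdom ?i}"
  have g: "smooth_atlas (atlas G)" "id_chart G \<in> atlas G" "0 \<in> cdom (id_chart G)"
    using G by (auto simp: lie_group_def)
  note S = lie_group_mult[OF G g(2) g(2) g(2)]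
  have e: "(?e, ?e) \<in> ?S"
    using g by (force simp: id_coord_def image_iff)
  \<comment> \<open>The direction \<open>(0, Z)\<close> selects the partial derivative in the second
    factor of the multiplication.\<close>
  have D: "coord_field G Z x = frechet_derivative ?F (at (x, ?e)) (0, Z)" if "(x, ?e) \<in> ?S" for x
  proof -
    have "(?F has_derivative frechet_derivative ?F (at (x, ?e))) (at (x, ?e))"
      using smooth_on_imp_differentiable[OF S(2) that] by (simp add: frechet_derivative_works)
    moreover have "((\<lambda>y. (x, y)) has_derivative (\<lambda>v. (0, v))) (at ?e)"
      by (auto intro!: derivative_eq_intros)
    ultimately have "((\<lambda>y. ?F (x, y)) has_derivative (\<lambda>v. frechet_derivative ?F (at (x, ?e)) (0, v))) (at ?e)"
      using has_derivative_compose by fastforce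
    then show ?thesis
      unfolding left_invariant_field_def by (simp add: frechet_derivative_at[symmetric])
  qed
  let ?D = "\<lambda>z. frechet_derivative ?F (at z) (0, Z)"
  have "?D differentiable (at (?e, ?e))"
    by (rule smooth_on_imp_differentiable[OF smooth_on_frechet_derivative[OF S(2)] e])
  then have "(?D \<circ> (\<lambda>x. (x, ?e))) differentiable (at ?e)"
    by (intro differentiable_chain_at) auto
  then obtain D' where D': "((\<lambda>x. ?D (x, ?e)) has_derivative D') (at ?e)"
    by (auto simp: differentiable_def comp_def)
  \<comment> \<open>The formula \<open>D\<close> holds only for points of this slice; its openness
    lets the derivative be transferred to the field itself.\<close>
  have "open ((\<lambda>x. (x, ?e)) -` ?S)"
    by (intro open_vimage S(1)) (auto intro!: continuous_intros)
  from has_derivative_transform_within_open[OF D' this]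
  have "(coord_field G Z has_derivative D') (at ?e)"
    using D e by auto
  then show ?thesis by (auto simp: differentiable_def)
qed

lemma left_invariant_field_carnot_prod:
  assumes "lie_group G" "lie_group H" "c \<in> atlas G" "d \<in> atlas H"
    and "fst p \<in> cdom c" "snd p \<in> cdom d"
  shows "left_invariant_field (carnot_prod G H) (prod_chart c d) X p =
    (left_invariant_field G c (fst X) (fst p), left_invariant_field H d (snd X) (snd p))"
proof -
  have "(\<lambda>x. cmap (prod_chart c d) (p + cinv (id_chart (carnot_prod G H)) x)) =
      map_prod (\<lambda>x. cmap c (fst p + cinv (id_chart G) x)) (\<lambda>x. cmap d (snd p + cinv (id_chart H) x))"
    by (auto simp: fun_eq_iff plus_prod_def)
  then show ?thesis
    unfolding left_invariant_field_def
    using frechet_derivative_map_prod[of "\<lambda>x. cmap c (fst p + cinv (id_chart G) x)"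
        "(id_coord G, id_coord H)" "\<lambda>x. cmap d (snd p + cinv (id_chart H) x)"] assms
    by (simp add: left_translation_differentiable map_prod_def case_prod_unfold)
qed

lemma open_id_chart_image:
  assumes "lie_group G"
  shows "open (cmap (id_chart G) ` cdom (id_chart G))" "id_coord G \<in> cmap (id_chart G) ` cdom (id_chart G)"
    "x \<in> cmap (id_chart G) ` cdom (id_chart G) \<Longrightarrow> cinv (id_chart G) x \<in> cdom (id_chart G)"
  using assms chart_inverse[of "atlas G"] by (auto simp: lie_group_def smooth_atlas_def id_coord_def)

text \<open>The bracket only sees the fields near the identity, and there, on the image of the
  product of the two identity charts, the fields split into pairs.\<close>

lemma lie_bracket_carnot_prod:
  assumes G: "lie_group G" and H: "lie_group H"
  shows "lie_bracket (carnot_prod G H) X Y =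
    (lie_bracket G (fst X) (fst Y), lie_bracket H (snd X) (snd Y))"
proof -
  let ?c = "id_chart G" and ?d = "id_chart H"
  have "frechet_derivative (coord_field (carnot_prod G H) Z) (at (id_coord G, id_coord H)) =
     map_prod (frechet_derivative (coord_field G (fst Z)) (at (id_coord G)))
       (frechet_derivative (coord_field H (snd Z)) (at (id_coord H)))" (is "_ = ?R") for Z
  proof -
    have m: "(map_prod (coord_field G (fst Z)) (coord_field H (snd Z)) has_derivative ?R)
        (at (id_coord G, id_coord H))"
      using coord_field_differentiable[OF G] coord_field_differentiable[OF H]
      by (intro has_derivative_map_prod) (auto simp: frechet_derivative_works)
    have "(coord_field (carnot_prod G H) Z has_derivative ?R) (at (id_coord G, id_coord H))"
    proof (rule has_derivative_transform_within_open[OF m])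
      show "open ((cmap ?c ` cdom ?c) \<times> (cmap ?d ` cdom ?d))"
        by (intro open_Times open_id_chart_image G H)
      show "(id_coord G, id_coord H) \<in> (cmap ?c ` cdom ?c) \<times> (cmap ?d ` cdom ?d)"
        using open_id_chart_image(2)[OF G] open_id_chart_image(2)[OF H] by (rule SigmaI)
      show "map_prod (coord_field G (fst Z)) (coord_field H (snd Z)) x = coord_field (carnot_prod G H) Z x"
        if "x \<in> (cmap ?c ` cdom ?c) \<times> (cmap ?d ` cdom ?d)" for x
        using that G H open_id_chart_image(3)[OF G, of "fst x"] open_id_chart_image(3)[OF H, of "snd x"]
          left_invariant_field_carnot_prod[OF G H, of ?c ?d "cinv (prod_chart ?c ?d) x" Z]
        by (simp add: lie_group_def mem_Times_iff map_prod_def case_prod_unfold)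
    qed
    then show ?thesis by (rule frechet_derivative_at[symmetric])
  qed
  then show ?thesis
    by (simp add: lie_bracket_def Let_def map_prod_def case_prod_unfold)
qed

text \<open>The field of \<open>0\<close> vanishes throughout the identity chart, so its derivative
  is zero, and the other term is a derivative evaluated at the zero vector.\<close>

lemma lie_bracket_zero_right:
  assumes G: "lie_group G"
  shows "lie_bracket G X 0 = 0"
proof -
  have z: "coord_field G 0 x = 0" if "x \<in> cmap (id_chart G) ` cdom (id_chart G)" for x
    unfolding left_invariant_field_def
    using G open_id_chart_image(3)[OF G that]
    by (intro linear_0 linear_frechet_derivative left_translation_differentiable) (auto simp: lie_group_def)
  have "frechet_derivative (coord_field G 0) (at (id_coord G)) = frechet_derivative (\<lambda>x. 0) (at (id_coord G))"
    by (rule frechet_derivative_transform_within_open[OF coord_field_differentiable[OF G]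
          open_id_chart_image(1,2)[OF G] z])
  moreover have "frechet_derivative (coord_field G X) (at (id_coord G)) 0 = 0"
    by (intro linear_0 linear_frechet_derivative coord_field_differentiable G)
  ultimately show ?thesis
    by (simp add: lie_bracket_def)
qed


section \<open>The stratification of the product\<close>

text \<open>The zeros put copies of \<open>A\<close> and \<open>B\<close> on the two axes inside
  \<open>A \<times> B\<close>, and these span the factors separately. For two nonzero singletons the
  span of the product would be just a line.\<close>

lemma span_Times_zero:
  fixes A :: "'a::real_vector set" and B :: "'b::real_vector set"
  assumes "0 \<in> A" "0 \<in> B"
  shows "span (A \<times> B) = span A \<times> span B"
proof
  show "span (A \<times> B) \<subseteq> span A \<times> span B"
    by (rule span_minimal)
      (auto simp: subspace_def zero_prod_def intro: span_base span_0 span_add span_scale)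
  have l: "linear (\<lambda>a. (a, 0) :: 'a \<times> 'b)" "linear (\<lambda>b. (0, b) :: 'a \<times> 'b)"
    by (auto intro!: linearI)
  have "(a, 0) \<in> span (A \<times> B)" if "a \<in> span A" for a
    using that linear_span_image[OF l(1), of A] span_mono[of "(\<lambda>a. (a, 0)) ` A" "A \<times> B"] assms by blast
  moreover have "(0, b) \<in> span (A \<times> B)" if "b \<in> span B" for b
    using that linear_span_image[OF l(2), of B] span_mono[of "(\<lambda>b. (0, b)) ` B" "A \<times> B"] assms by blast
  ultimately have "(a, 0) + (0, b) \<in> span (A \<times> B)" if "a \<in> span A" "b \<in> span B" for a b
    using that by (intro span_add)
  then show "span A \<times> span B \<subseteq> span (A \<times> B)" by auto
qed

lemma bracket_span_carnot_prod:
  assumes G: "lie_group G" and H: "lie_group H" and 0: "0 \<in> V" "0 \<in> W" "0 \<in> V'" "0 \<in> W'"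
  shows "bracket_span (carnot_prod G H) (V \<times> V') (W \<times> W') = bracket_span G V W \<times> bracket_span H V' W'"
proof -
  have "{lie_bracket (carnot_prod G H) X Y | X Y. X \<in> V \<times> V' \<and> Y \<in> W \<times> W'} =
      {lie_bracket G X Y | X Y. X \<in> V \<and> Y \<in> W} \<times> {lie_bracket H X Y | X Y. X \<in> V' \<and> Y \<in> W'}"
    unfolding lie_bracket_carnot_prod[OF G H] by fastforce
  moreover have "0 \<in> {lie_bracket G X Y | X Y. X \<in> V \<and> Y \<in> W}"
    "0 \<in> {lie_bracket H X Y | X Y. X \<in> V' \<and> Y \<in> W'}"
    using 0 lie_bracket_zero_right[OF G, of 0] lie_bracket_zero_right[OF H, of 0] by force+
  ultimately show ?thesis
    unfolding bracket_span_def by (simp add: span_Times_zero)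
qed

text \<open>The step of the product is the maximum of the two, so the factor of smaller step is
  asked for this relation beyond its own step. There both sides are \<open>{0}\<close>.\<close>

lemma bracket_span_layer:
  assumes G: "lie_group G" "stratification G" and i: "1 \<le> i"
  shows "bracket_span G (layer G 1) (layer G i) = layer G (i + 1)"
proof -
  have l: "\<And>i. i \<notin> {1..step G} \<Longrightarrow> layer G i = {0}" and "subspace (layer G 1)"
    using G by (auto simp: stratification_def)
  then have 0: "0 \<in> layer G 1" by (simp add: subspace_0)
  consider "i < step G" | "i = step G" | "i > step G" by linarith
  then show ?thesis
  proof cases
    case 3
    have "{lie_bracket G X Y | X Y. X \<in> layer G 1 \<and> Y \<in> {0}} = {0}"
      using 0 by (auto simp: lie_bracket_zero_right[OF G(1)])
    then show ?thesis using l[of i] l[of "i + 1"] 3 by (simp add: bracket_span_def)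
  qed (use G i l[of "i + 1"] in \<open>auto simp: stratification_def\<close>)
qed

text \<open>Layers outside the range are \<open>{0}\<close>, so the extra summands vanish. This
  brings both factors to a common upper limit of summation.\<close>

lemma stratification_unique_sum:
  assumes G: "stratification G" and n: "step G \<le> n"
  shows "\<exists>!f. (\<forall>i. f i \<in> layer G i) \<and> X = (\<Sum>i = 1..n. f i)"
proof -
  have "(\<Sum>i = 1..n. f i) = (\<Sum>i = 1..step G. f i)" if "\<forall>i. f i \<in> layer G i" for f
  proof (rule sum.mono_neutral_right)
    show "\<forall>i\<in>{1..n} - {1..step G}. f i = 0"
    proof
      fix i assume "i \<in> {1..n} - {1..step G}"
      then have "layer G i = {0}" using G by (auto simp: stratification_def)
      then show "f i = 0" using that by blast
    qed
  qed (use n in auto)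
  then have "((\<forall>i. f i \<in> layer G i) \<and> X = (\<Sum>i = 1..n. f i)) \<longleftrightarrow>
      ((\<forall>i. f i \<in> layer G i) \<and> X = (\<Sum>i = 1..step G. f i))" for f
    by auto
  then show ?thesis using G by (simp add: stratification_def)
qed

lemma fst_snd_sum: "(\<Sum>i\<in>I. f i) = (\<Sum>i\<in>I. fst (f i), \<Sum>i\<in>I. snd (f i))"
  by (simp add: prod_eq_iff fst_sum snd_sum)

lemma stratification_carnot_prod:
  assumes G: "lie_group G" "stratification G" and H: "lie_group H" "stratification H"
  shows "stratification (carnot_prod G H)"
proof -
  let ?n = "max (step G) (step H)"
  have sub: "subspace (layer G i)" "subspace (layer H i)" for i
    using G H by (auto simp: stratification_def)
  have triv: "layer G i = {0}" "layer H i = {0}" if "i \<notin> {1..?n}" for i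
    using that G H by (auto simp: stratification_def)
  have n: "1 \<le> ?n" using G by (auto simp: stratification_def)
  have br: "bracket_span (carnot_prod G H) (layer G 1 \<times> layer H 1) (layer G i \<times> layer H i) =
      layer G (i + 1) \<times> layer H (i + 1)" if "1 \<le> i" for i
    using that bracket_span_carnot_prod[OF G(1) H(1)] bracket_span_layer[OF G] bracket_span_layer[OF H] sub
    by (simp add: subspace_0)
  have "\<exists>!f. (\<forall>i. f i \<in> layer G i \<times> layer H i) \<and> X = (\<Sum>i = 1..?n. f i)" for X
  proof -
    obtain f g where f: "\<forall>i. f i \<in> layer G i" "fst X = (\<Sum>i = 1..?n. f i)"
      and g: "\<forall>i. g i \<in> layer H i" "snd X = (\<Sum>i = 1..?n. g i)"
      using stratification_unique_sum[OF G(2), of ?n "fst X"]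
        stratification_unique_sum[OF H(2), of ?n "snd X"] by auto
    show ?thesis
    proof (rule ex1I[of _ "\<lambda>i. (f i, g i)"])
      show "(\<forall>i. (f i, g i) \<in> layer G i \<times> layer H i) \<and> X = (\<Sum>i = 1..?n. (f i, g i))"
        using f g by (subst fst_snd_sum) (auto simp: prod_eq_iff)
    next
      fix h assume "(\<forall>i. h i \<in> layer G i \<times> layer H i) \<and> X = (\<Sum>i = 1..?n. h i)"
      then have "\<forall>i. fst (h i) \<in> layer G i" "fst X = (\<Sum>i = 1..?n. fst (h i))"
        "\<forall>i. snd (h i) \<in> layer H i" "snd X = (\<Sum>i = 1..?n. snd (h i))"
        by (auto simp: mem_Times_iff fst_sum snd_sum)
      then have "(\<lambda>i. fst (h i)) = f" "(\<lambda>i. snd (h i)) = g"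
        using f g stratification_unique_sum[OF G(2), of ?n "fst X"]
          stratification_unique_sum[OF H(2), of ?n "snd X"] by (metis max.cobounded1 max.cobounded2)+
      then show "h = (\<lambda>i. (f i, g i))" by (auto simp: fun_eq_iff prod_eq_iff)
    qed
  qed
  \<comment> \<open>At least one factor attains the maximal step, and its top layer is nontrivial;
    the other component can be taken to be \<open>0\<close>.\<close>
  moreover have "layer G ?n \<times> layer H ?n \<noteq> {0}"
  proof -
    have "layer G (step G) \<noteq> {0}" "layer H (step H) \<noteq> {0}"
      using G H by (auto simp: stratification_def)
    moreover have "0 \<in> layer G ?n" "0 \<in> layer H ?n" using sub by (simp_all add: subspace_0)
    moreover have "?n = step G \<or> ?n = step H" by linarith
    ultimately have "layer G ?n \<noteq> {0} \<or> layer H ?n \<noteq> {0}" by auto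
    then obtain z where "z \<in> layer G ?n \<times> layer H ?n" "z \<noteq> 0"
      using \<open>0 \<in> layer G ?n\<close> \<open>0 \<in> layer H ?n\<close> unfolding zero_prod_def by blast
    then show ?thesis by blast
  qed
  moreover have "subspace (layer G i \<times> layer H i)" for i
    using sub by (auto simp: subspace_def zero_prod_def)
  moreover have "layer G i \<times> layer H i = {0}" if "i \<notin> {1..?n}" for i
    using triv[OF that] by (simp add: zero_prod_def)
  \<comment> \<open>With \<open>br\<close> at the top index this yields the last condition, that
    brackets with the top layer vanish.\<close>
  moreover have "layer G (?n + 1) \<times> layer H (?n + 1) = {0}"
    using triv[of "?n + 1"] by (simp add: zero_prod_def)
  ultimately show ?thesis
    unfolding stratification_def carnot_prod_simps using n br by auto
qed

text \<open>Simple connectedness is taken as free homotopy of any two loops. Homotopies of the two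
  components live on the same parameter square, so they can be paired pointwise.\<close>

lemma simply_connected_UNIV_prod:
  assumes "simply_connected (UNIV :: 'a::topological_space set)"
    and "simply_connected (UNIV :: 'b::topological_space set)"
  shows "simply_connected (UNIV :: ('a \<times> 'b) set)"
  unfolding simply_connected_def
proof (intro allI impI, elim conjE)
  fix p q :: "real \<Rightarrow> 'a \<times> 'b"
  assume p: "path p" "pathfinish p = pathstart p" and q: "path q" "pathfinish q = pathstart q"
  have "path (\<lambda>t. fst (p t))" "path (\<lambda>t. fst (q t))" "path (\<lambda>t. snd (p t))" "path (\<lambda>t. snd (q t))"
    using p q by (auto simp: path_def intro: continuous_intros)
  then have "homotopic_loops UNIV (\<lambda>t. fst (p t)) (\<lambda>t. fst (q t))"
    "homotopic_loops UNIV (\<lambda>t. snd (p t)) (\<lambda>t. snd (q t))"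
    using p q assms by (auto simp: simply_connected_def pathstart_def pathfinish_def)
  then obtain h k where "continuous_on ({0..1::real} \<times> {0..1::real}) h" "continuous_on ({0..1::real} \<times> {0..1::real}) k"
    "\<forall>x\<in>{0..1}. h (0, x) = fst (p x)" "\<forall>x\<in>{0..1}. h (1, x) = fst (q x)"
    "\<forall>x\<in>{0..1}. k (0, x) = snd (p x)" "\<forall>x\<in>{0..1}. k (1, x) = snd (q x)"
    "\<forall>t\<in>{0..1}. h (t, 1) = h (t, 0)" "\<forall>t\<in>{0..1}. k (t, 1) = k (t, 0)"
    unfolding homotopic_loops by (auto simp: pathstart_def pathfinish_def)
  then show "homotopic_loops UNIV p q"
    unfolding homotopic_loops
    by (intro exI[of _ "\<lambda>z. (h z, k z)"]) (auto simp: pathstart_def pathfinish_def continuous_on_Pair)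
qed

lemma carnot_group_carnot_prod:
  assumes "carnot_group G" "carnot_group H"
  shows "carnot_group (carnot_prod G H)"
  using assms connected_Times[of "UNIV :: 'a set" "UNIV :: 'c set"]
  by (simp add: carnot_group_def lie_group_carnot_prod stratification_carnot_prod simply_connected_UNIV_prod)


section \<open>Controls and the end-point map of the product\<close>

lemma absolutely_integrable_Pair_iff:
  fixes f :: "real \<Rightarrow> 'a::euclidean_space \<times> 'b::euclidean_space"
  shows "f absolutely_integrable_on S \<longleftrightarrow>
    (\<lambda>t. fst (f t)) absolutely_integrable_on S \<and> (\<lambda>t. snd (f t)) absolutely_integrable_on S"
proof
  assume "f absolutely_integrable_on S"
  then show "(\<lambda>t. fst (f t)) absolutely_integrable_on S \<and> (\<lambda>t. snd (f t)) absolutely_integrable_on S"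
    using absolutely_integrable_linear[OF _ bounded_linear_fst, where f = f and s = S]
      absolutely_integrable_linear[OF _ bounded_linear_snd, where f = f and s = S] by (simp add: comp_def)
next
  assume *: "(\<lambda>t. fst (f t)) absolutely_integrable_on S \<and> (\<lambda>t. snd (f t)) absolutely_integrable_on S"
  \<comment> \<open>The pair is recovered as the sum of its two axis parts, each a bounded linear
    image of an integrable component.\<close>
  have "bounded_linear (\<lambda>x. (x, 0) :: 'a \<times> 'b)" "bounded_linear (\<lambda>x. (0, x) :: 'a \<times> 'b)"
    by (auto simp: linear_conv_bounded_linear[symmetric] intro!: linearI)
  note this[THEN absolutely_integrable_linear[rotated]]
  note set_integral_add(1)[OF this(1)[OF conjunct1[OF *]] this(2)[OF conjunct2[OF *]]]
  then show "f absolutely_integrable_on S"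
    by (simp add: comp_def)
qed

lemma integral_Pair:
  fixes f :: "real \<Rightarrow> 'a::euclidean_space \<times> 'b::euclidean_space"
  assumes "f integrable_on S"
  shows "integral S f = (integral S (\<lambda>t. fst (f t)), integral S (\<lambda>t. snd (f t)))"
  using integral_linear[OF assms bounded_linear_fst] integral_linear[OF assms bounded_linear_snd]
  by (simp add: comp_def prod_eq_iff)

text \<open>This is the condition of \<open>has_control\<close> for one chart and one interval,
  isolated because it is additive in the interval and splits over a product chart.\<close>

definition solves_on ::
    "('g::{topological_space, group_add}, 'e::euclidean_space) stratified_group \<Rightarrow>
     ('g, 'e) chart \<Rightarrow> (real \<Rightarrow> 'g) \<Rightarrow> (real \<Rightarrow> 'e) \<Rightarrow> real \<Rightarrow> real \<Rightarrow> bool" where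
  "solves_on G c \<gamma> h a b \<longleftrightarrow>
     (\<lambda>t. left_invariant_field G c (h t) (\<gamma> t)) absolutely_integrable_on {a..b} \<and>
     cmap c (\<gamma> b) = cmap c (\<gamma> a) + integral {a..b} (\<lambda>t. left_invariant_field G c (h t) (\<gamma> t))"

lemma has_control_iff_solves_on:
  "has_control G \<gamma> h \<longleftrightarrow>
     continuous_on {0..1} \<gamma> \<and> \<gamma> 0 = 0 \<and>
     (\<forall>c\<in>atlas G. \<forall>a b. 0 \<le> a \<and> a \<le> b \<and> b \<le> 1 \<and> \<gamma> ` {a..b} \<subseteq> cdom c \<longrightarrow> solves_on G c \<gamma> h a b)"
  unfolding has_control_def solves_on_def ..

lemma solves_on_combine:
  assumes "solves_on G c \<gamma> h a m" "solves_on G c \<gamma> h m b" "a \<le> m" "m \<le> b"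
  shows "solves_on G c \<gamma> h a b"
proof -
  let ?f = "\<lambda>t. left_invariant_field G c (h t) (\<gamma> t)"
  have i: "?f absolutely_integrable_on {a..b}"
    using assms absolutely_integrable_on_combine[where f = ?f and a = a and c = m and b = b] by (simp add: solves_on_def)
  then have "integral {a..b} ?f = integral {a..m} ?f + integral {m..b} ?f"
    using Henstock_Kurzweil_Integration.integral_combine[OF assms(3,4), where f = ?f]
    by (simp add: absolutely_integrable_on_def)
  then show ?thesis using assms i by (simp add: solves_on_def add.assoc)
qed

text \<open>As the curve stays in both chart domains over the whole interval, the integrand is a
  pair at every time and the integral is taken componentwise.\<close>

lemma solves_on_carnot_prod:
  assumes "lie_group G" "lie_group H" "c \<in> atlas G" "d \<in> atlas H" "a \<le> b"
    and \<gamma>: "\<gamma> ` {a..b} \<subseteq> cdom c \<times> cdom d"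
  shows "solves_on (carnot_prod G H) (prod_chart c d) \<gamma> h a b \<longleftrightarrow>
    solves_on G c (\<lambda>t. fst (\<gamma> t)) (\<lambda>t. fst (h t)) a b \<and>
    solves_on H d (\<lambda>t. snd (\<gamma> t)) (\<lambda>t. snd (h t)) a b"
proof -
  let ?f = "\<lambda>t. left_invariant_field (carnot_prod G H) (prod_chart c d) (h t) (\<gamma> t)"
  let ?g = "\<lambda>t. (left_invariant_field G c (fst (h t)) (fst (\<gamma> t)),
    left_invariant_field H d (snd (h t)) (snd (\<gamma> t)))"
  have eq: "?f t = ?g t" if "t \<in> {a..b}" for t
    using \<gamma> that by (intro left_invariant_field_carnot_prod assms) (auto simp: image_subset_iff mem_Times_iff)
  have "?f absolutely_integrable_on {a..b} \<longleftrightarrow> ?g absolutely_integrable_on {a..b}"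
    by (intro set_integrable_cong refl eq)
  moreover have "integral {a..b} ?f = integral {a..b} ?g"
    by (intro integral_cong eq)
  ultimately show ?thesis
    using integral_Pair[where f = ?g and S = "{a..b}"] absolutely_integrable_Pair_iff[where f = ?g and S = "{a..b}"]
    by (auto simp: solves_on_def absolutely_integrable_on_def prod_eq_iff)
qed

text \<open>A curve in the product need not stay in a single chart of one factor while its other
  component stays in a given chart, so the integral equation of a component is glued from short
  intervals.\<close>

lemma has_control_local:
  assumes \<gamma>: "continuous_on {0..1} \<gamma>" "\<gamma> 0 = 0"
    and loc: "\<And>c t. c \<in> atlas G \<Longrightarrow> t \<in> {0..1} \<Longrightarrow> \<exists>\<delta>>0. \<forall>a b. 0 \<le> a \<and> a \<le> t \<and> t \<le> b \<and> b \<le> 1 \<and>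
      b - a < \<delta> \<and> \<gamma> ` {a..b} \<subseteq> cdom c \<longrightarrow> solves_on G c \<gamma> h a b"
  shows "has_control G \<gamma> h"
  unfolding has_control_iff_solves_on
proof (intro conjI ballI allI impI \<gamma>)
  fix c a b
  assume c: "c \<in> atlas G" and ab: "0 \<le> a \<and> a \<le> b \<and> b \<le> 1 \<and> \<gamma> ` {a..b} \<subseteq> cdom c"
  have "a \<le> b" using ab by simp
  \<comment> \<open>Bisection tests every short interval around a point, including those that stick
    out of \<open>{a..b}\<close>, where the curve may leave the chart; the bounds in the predicate
    exclude them.\<close>
  then have "a \<le> a \<and> b \<le> b \<longrightarrow> solves_on G c \<gamma> h a b"
  proof (induction rule: Bolzano[where P = "\<lambda>x y. a \<le> x \<and> y \<le> b \<longrightarrow> solves_on G c \<gamma> h x y"])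
    case (trans x y z)
    then show ?case using solves_on_combine[of G c \<gamma> h x y z] by auto
  next
    case (local t)
    then obtain \<delta> where "\<delta> > 0" and \<delta>: "\<And>x y. 0 \<le> x \<and> x \<le> t \<and> t \<le> y \<and> y \<le> 1 \<and>
      y - x < \<delta> \<and> \<gamma> ` {x..y} \<subseteq> cdom c \<Longrightarrow> solves_on G c \<gamma> h x y"
      using loc[OF c, of t] ab by auto
    have "solves_on G c \<gamma> h x y" if "x \<le> t" "t \<le> y" "y - x < \<delta>" "a \<le> x" "y \<le> b" for x y
      using that ab by (intro \<delta>) (auto simp: image_subset_iff)
    then show ?case using \<open>\<delta> > 0\<close> by blast
  qed
  then show "solves_on G c \<gamma> h a b" by simp
qed

lemma eventually_in_chart:
  fixes \<gamma> :: "real \<Rightarrow> 'g::topological_space"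
  assumes A: "smooth_atlas A" and \<gamma>: "continuous_on {0..1} \<gamma>" and t: "t \<in> {0..1}"
  obtains d \<delta> where "d \<in> A" "\<delta> > 0"
    "\<And>a b. 0 \<le> a \<Longrightarrow> a \<le> t \<Longrightarrow> t \<le> b \<Longrightarrow> b \<le> 1 \<Longrightarrow> b - a < \<delta> \<Longrightarrow> \<gamma> ` {a..b} \<subseteq> cdom d"
proof -
  obtain d where d: "d \<in> A" "\<gamma> t \<in> cdom d" "open (cdom d)"
    using A unfolding smooth_atlas_def by blast
  \<comment> \<open>The curve is continuous only on \<open>{0..1}\<close>, so the preimage of the
    chart domain is open merely relative to it; \<open>U\<close> is an open set with the same
    trace.\<close>
  obtain U where U: "open U" "U \<inter> {0..1} = \<gamma> -` cdom d \<inter> {0..1}"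
    using \<gamma> d(3) unfolding continuous_on_open_invariant by blast
  then have "t \<in> U" using t d by blast
  then obtain \<delta> where "\<delta> > 0" and \<delta>: "\<And>s. dist s t < \<delta> \<Longrightarrow> s \<in> U"
    using U(1) by (auto simp: open_dist)
  have "\<gamma> s \<in> cdom d" if "0 \<le> a" "a \<le> t" "t \<le> b" "b \<le> 1" "b - a < \<delta>" "s \<in> {a..b}" for a b s
  proof -
    have "dist s t < \<delta>" using that by (auto simp: dist_real_def)
    then have "s \<in> U \<inter> {0..1}" using \<delta> that by auto
    then show ?thesis using U(2) by blast
  qed
  then show thesis using that[OF d(1) \<open>\<delta> > 0\<close>] by blast
qed

lemma has_control_carnot_prod_iff:
  assumes G: "lie_group G" and H: "lie_group H"
  shows "has_control (carnot_prod G H) \<gamma> h \<longleftrightarrow>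
    has_control G (\<lambda>t. fst (\<gamma> t)) (\<lambda>t. fst (h t)) \<and> has_control H (\<lambda>t. snd (\<gamma> t)) (\<lambda>t. snd (h t))"
    (is "?P \<longleftrightarrow> ?Q")
proof
  have at: "smooth_atlas (atlas G)" "smooth_atlas (atlas H)"
    using G H by (auto simp: lie_group_def)
  assume P: ?P
  then have \<gamma>: "continuous_on {0..1} (\<lambda>t. fst (\<gamma> t))" "continuous_on {0..1} (\<lambda>t. snd (\<gamma> t))" "\<gamma> 0 = 0"
    by (auto simp: has_control_iff_solves_on intro: continuous_intros)
  have sol: "solves_on G c (\<lambda>t. fst (\<gamma> t)) (\<lambda>t. fst (h t)) a b \<and>
      solves_on H d (\<lambda>t. snd (\<gamma> t)) (\<lambda>t. snd (h t)) a b"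
    if "c \<in> atlas G" "d \<in> atlas H" "0 \<le> a" "a \<le> b" "b \<le> 1"
      "(\<lambda>t. fst (\<gamma> t)) ` {a..b} \<subseteq> cdom c" "(\<lambda>t. snd (\<gamma> t)) ` {a..b} \<subseteq> cdom d" for c d a b
  proof -
    have sub: "\<gamma> ` {a..b} \<subseteq> cdom c \<times> cdom d"
      using that by (auto simp: image_subset_iff mem_Times_iff)
    moreover have "prod_chart c d \<in> atlas (carnot_prod G H)"
      using that by (simp add: prod_atlasI)
    ultimately have "solves_on (carnot_prod G H) (prod_chart c d) \<gamma> h a b"
      using P that unfolding has_control_iff_solves_on by fastforce
    then show ?thesis
      using solves_on_carnot_prod[OF G H that(1,2,4) sub] by blast
  qed
  have "has_control G (\<lambda>t. fst (\<gamma> t)) (\<lambda>t. fst (h t))"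
  proof (rule has_control_local)
    fix c t assume c: "c \<in> atlas G" and t: "t \<in> {0..1::real}"
    \<comment> \<open>Near \<open>t\<close> the other component stays in one chart \<open>d\<close>,
      which completes \<open>c\<close> to a product chart on short intervals.\<close>
    obtain d \<delta> where d: "d \<in> atlas H" "\<delta> > 0" "\<And>a b. 0 \<le> a \<Longrightarrow> a \<le> t \<Longrightarrow> t \<le> b \<Longrightarrow> b \<le> 1 \<Longrightarrow>
        b - a < \<delta> \<Longrightarrow> (\<lambda>t. snd (\<gamma> t)) ` {a..b} \<subseteq> cdom d"
      using eventually_in_chart[OF at(2) \<gamma>(2) t] by metis
    show "\<exists>\<delta>>0. \<forall>a b. 0 \<le> a \<and> a \<le> t \<and> t \<le> b \<and> b \<le> 1 \<and> b - a < \<delta> \<and>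
        (\<lambda>t. fst (\<gamma> t)) ` {a..b} \<subseteq> cdom c \<longrightarrow> solves_on G c (\<lambda>t. fst (\<gamma> t)) (\<lambda>t. fst (h t)) a b"
      using d(2,3) sol[OF c d(1)] by (intro exI[of _ \<delta>]) (meson order_trans)
  qed (use \<gamma> in auto)
  moreover have "has_control H (\<lambda>t. snd (\<gamma> t)) (\<lambda>t. snd (h t))"
  proof (rule has_control_local)
    fix d t assume d: "d \<in> atlas H" and t: "t \<in> {0..1::real}"
    obtain c \<delta> where c: "c \<in> atlas G" "\<delta> > 0" "\<And>a b. 0 \<le> a \<Longrightarrow> a \<le> t \<Longrightarrow> t \<le> b \<Longrightarrow> b \<le> 1 \<Longrightarrow>
        b - a < \<delta> \<Longrightarrow> (\<lambda>t. fst (\<gamma> t)) ` {a..b} \<subseteq> cdom c"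
      using eventually_in_chart[OF at(1) \<gamma>(1) t] by metis
    show "\<exists>\<delta>>0. \<forall>a b. 0 \<le> a \<and> a \<le> t \<and> t \<le> b \<and> b \<le> 1 \<and> b - a < \<delta> \<and>
        (\<lambda>t. snd (\<gamma> t)) ` {a..b} \<subseteq> cdom d \<longrightarrow> solves_on H d (\<lambda>t. snd (\<gamma> t)) (\<lambda>t. snd (h t)) a b"
      using c(2,3) sol[OF c(1) d] by (intro exI[of _ \<delta>]) (meson order_trans)
  qed (use \<gamma> in auto)
  ultimately show ?Q ..
next
  assume Q: ?Q
  have "solves_on (carnot_prod G H) e \<gamma> h a b"
    if "e \<in> atlas (carnot_prod G H)" "0 \<le> a" "a \<le> b" "b \<le> 1" "\<gamma> ` {a..b} \<subseteq> cdom e" for e a b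
  proof -
    obtain c d where cd: "e = prod_chart c d" "c \<in> atlas G" "d \<in> atlas H"
      using \<open>e \<in> _\<close> unfolding carnot_prod_simps by (rule prod_atlasE)
    then have "(\<lambda>t. fst (\<gamma> t)) ` {a..b} \<subseteq> cdom c" "(\<lambda>t. snd (\<gamma> t)) ` {a..b} \<subseteq> cdom d"
      using that by (auto simp: image_subset_iff mem_Times_iff)
    then have "solves_on G c (\<lambda>t. fst (\<gamma> t)) (\<lambda>t. fst (h t)) a b"
      "solves_on H d (\<lambda>t. snd (\<gamma> t)) (\<lambda>t. snd (h t)) a b"
      using Q cd that unfolding has_control_iff_solves_on by blast+
    then show ?thesis
      using solves_on_carnot_prod[OF G H cd(2,3) that(3), of \<gamma> h] that cd by simp
  qed
  moreover have "continuous_on {0..1} \<gamma>"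
    using Q continuous_on_Pair[of "{0..1}" "\<lambda>t. fst (\<gamma> t)" "\<lambda>t. snd (\<gamma> t)"]
    by (simp add: has_control_iff_solves_on)
  moreover have "\<gamma> 0 = 0"
    using Q by (simp add: has_control_iff_solves_on prod_eq_iff)
  ultimately show ?P
    unfolding has_control_iff_solves_on by blast
qed

section \<open>Controls and the essential supremum norm on the product\<close>

lemma esssup_norm_fst_snd_le:
  fixes h :: "'t \<Rightarrow> 'a::euclidean_space \<times> 'b::euclidean_space"
  assumes [measurable]: "h \<in> borel_measurable M"
  shows "esssup M (\<lambda>t. ereal (norm (fst (h t)))) \<le> esssup M (\<lambda>t. ereal (norm (h t)))"
    and "esssup M (\<lambda>t. ereal (norm (snd (h t)))) \<le> esssup M (\<lambda>t. ereal (norm (h t)))"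
proof -
  \<comment> \<open>Measurability matters here: \<open>esssup\<close> of a non-measurable function
    is the top element, which would break the comparison.\<close>
  have "(\<lambda>t. fst (h t)) \<in> borel_measurable M" "(\<lambda>t. snd (h t)) \<in> borel_measurable M"
    by (auto intro!: measurable_compose[OF assms] borel_measurable_continuous_onI continuous_intros)
  note [measurable] = this
  have "norm (fst z) \<le> norm z" "norm (snd z) \<le> norm z" for z :: "'a \<times> 'b"
    by (metis norm_fst_le norm_snd_le prod.collapse)+
  then show "esssup M (\<lambda>t. ereal (norm (fst (h t)))) \<le> esssup M (\<lambda>t. ereal (norm (h t)))"
    "esssup M (\<lambda>t. ereal (norm (snd (h t)))) \<le> esssup M (\<lambda>t. ereal (norm (h t)))"
    by (intro esssup_mono; simp)+
qed

lemma controls_carnot_prod_iff: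
  "h \<in> controls (carnot_prod G H) \<longleftrightarrow>
     (\<lambda>t. fst (h t)) \<in> controls G \<and> (\<lambda>t. snd (h t)) \<in> controls H"
  (is "?P \<longleftrightarrow> ?Q")
proof
  assume P: ?P
  then have m: "h \<in> borel_measurable (lebesgue_on {0..1})" by (simp add: controls_def)
  have "(\<lambda>t. fst (h t)) \<in> borel_measurable (lebesgue_on {0..1})"
    "(\<lambda>t. snd (h t)) \<in> borel_measurable (lebesgue_on {0..1})"
    by (auto intro!: measurable_compose[OF m] borel_measurable_continuous_onI continuous_intros)
  moreover have "AE t in lebesgue_on {0..1}. fst (h t) \<in> layer G 1"
    "AE t in lebesgue_on {0..1}. snd (h t) \<in> layer H 1"
    using P by (auto simp: controls_def mem_Times_iff elim: eventually_mono)
  ultimately show ?Q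
    using P esssup_norm_fst_snd_le[OF m] by (auto simp: controls_def)
next
  assume Q: ?Q
  let ?M = "lebesgue_on {0..1::real}"
  have m: "(\<lambda>t. fst (h t)) \<in> borel_measurable ?M" "(\<lambda>t. snd (h t)) \<in> borel_measurable ?M"
    using Q by (auto simp: controls_def)
  have m': "h \<in> borel_measurable ?M" using borel_measurable_Pair[OF m] by simp
  have "AE t in ?M. fst (h t) \<in> layer G 1" "AE t in ?M. snd (h t) \<in> layer H 1"
    using Q by (auto simp: controls_def)
  then have l: "AE t in ?M. h t \<in> layer G 1 \<times> layer H 1"
    by eventually_elim (simp add: mem_Times_iff)
  have "esssup ?M (\<lambda>t. ereal (norm (h t))) \<le>
      esssup ?M (\<lambda>t. ereal (norm (fst (h t))) + ereal (norm (snd (h t))))"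
  proof (rule esssup_mono)
    show "(\<lambda>t. ereal (norm (h t))) \<in> borel_measurable ?M"
      using m' by measurable
    show "ereal (norm (h t)) \<le> ereal (norm (fst (h t))) + ereal (norm (snd (h t)))" for t
      using norm_Pair_le[of "fst (h t)" "snd (h t)"] by simp
  qed
  also have "\<dots> \<le> esssup ?M (\<lambda>t. ereal (norm (fst (h t)))) + esssup ?M (\<lambda>t. ereal (norm (snd (h t))))"
    by (rule esssup_add)
  also have "\<dots> < \<infinity>"
    using Q by (auto simp: controls_def)
  finally show ?P
    using m' l by (simp add: controls_def)
qed

lemma esssup_norm_nonneg: "0 \<le> esssup (lebesgue_on {0..1::real}) (\<lambda>t. ereal (norm (h t)))"
proof -
  let ?M = "lebesgue_on {0..1::real}"
  \<comment> \<open>On a space of measure zero the essential supremum would be minus infinity, even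
    for a nonnegative function.\<close>
  have "emeasure ?M (space ?M) \<noteq> 0"
    by (simp add: emeasure_restrict_space)
  then have "esssup ?M (\<lambda>t. 0 :: ereal) = 0" by (rule esssup_const)
  then show ?thesis
    using esssup_mono[of "\<lambda>t. 0 :: ereal" ?M "\<lambda>t. ereal (norm (h t))"] by simp
qed

lemma Linf_norm_nonneg: "0 \<le> Linf_norm h"
  by (simp add: Linf_norm_def real_of_ereal_pos esssup_norm_nonneg)

text \<open>\<open>real_of_ereal\<close> sends infinity to \<open>0\<close> and so is not monotone
  in general. Membership in \<open>controls G\<close> keeps the larger essential supremum
  finite.\<close>

lemma Linf_norm_fst_snd_le:
  fixes h :: "real \<Rightarrow> 'a::euclidean_space \<times> 'b::euclidean_space"
  assumes h: "h \<in> controls G"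
  shows "Linf_norm (\<lambda>t. fst (h t)) \<le> Linf_norm h" "Linf_norm (\<lambda>t. snd (h t)) \<le> Linf_norm h"
proof -
  let ?M = "lebesgue_on {0..1::real}"
  have m: "h \<in> borel_measurable ?M" and fin: "esssup ?M (\<lambda>t. ereal (norm (h t))) < \<infinity>"
    using h by (auto simp: controls_def)
  then show "Linf_norm (\<lambda>t. fst (h t)) \<le> Linf_norm h" "Linf_norm (\<lambda>t. snd (h t)) \<le> Linf_norm h"
    unfolding Linf_norm_def
    using esssup_norm_nonneg esssup_norm_fst_snd_le[OF m] by (auto intro!: real_of_ereal_positive_mono)
qed

text \<open>Existence pairs the two solutions; uniqueness projects a competing solution to the
  factors. These are the two directions of \<open>has_control_carnot_prod_iff\<close>.\<close>

lemma endpoint_map_carnot_prod: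
  assumes G: "lie_group G" and H: "lie_group H" and E: "endpoint_map G E" and F: "endpoint_map H F"
  shows "endpoint_map (carnot_prod G H) (\<lambda>h. (E (\<lambda>t. fst (h t)), F (\<lambda>t. snd (h t))))"
  unfolding endpoint_map_def
proof
  fix h :: "real \<Rightarrow> 'b \<times> 'd" assume "h \<in> controls (carnot_prod G H)"
  then have "(\<lambda>t. fst (h t)) \<in> controls G" "(\<lambda>t. snd (h t)) \<in> controls H"
    by (simp_all add: controls_carnot_prod_iff)
  with E F obtain \<gamma> \<eta> where \<gamma>: "has_control G \<gamma> (\<lambda>t. fst (h t))" "E (\<lambda>t. fst (h t)) = \<gamma> 1"
      "\<And>\<gamma>'. has_control G \<gamma>' (\<lambda>t. fst (h t)) \<Longrightarrow> \<forall>t\<in>{0..1}. \<gamma>' t = \<gamma> t"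
    and \<eta>: "has_control H \<eta> (\<lambda>t. snd (h t))" "F (\<lambda>t. snd (h t)) = \<eta> 1"
      "\<And>\<eta>'. has_control H \<eta>' (\<lambda>t. snd (h t)) \<Longrightarrow> \<forall>t\<in>{0..1}. \<eta>' t = \<eta> t"
    unfolding endpoint_map_def by meson
  have "has_control (carnot_prod G H) (\<lambda>t. (\<gamma> t, \<eta> t)) h"
    using \<gamma>(1) \<eta>(1) by (simp add: has_control_carnot_prod_iff[OF G H])
  moreover have "\<theta> t = (\<gamma> t, \<eta> t)" if "has_control (carnot_prod G H) \<theta> h" "t \<in> {0..1}" for \<theta> t
  proof -
    have "has_control G (\<lambda>t. fst (\<theta> t)) (\<lambda>t. fst (h t))" "has_control H (\<lambda>t. snd (\<theta> t)) (\<lambda>t. snd (h t))"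
      using that(1) by (simp_all add: has_control_carnot_prod_iff[OF G H])
    then show ?thesis using \<gamma>(3) \<eta>(3) that(2) by (simp add: prod_eq_iff)
  qed
  ultimately show "\<exists>\<gamma>. has_control (carnot_prod G H) \<gamma> h \<and>
      (\<forall>\<gamma>'. has_control (carnot_prod G H) \<gamma>' h \<longrightarrow> (\<forall>t\<in>{0..1}. \<gamma>' t = \<gamma> t)) \<and>
      (E (\<lambda>t. fst (h t)), F (\<lambda>t. snd (h t))) = \<gamma> 1"
    unfolding \<gamma>(2) \<eta>(2) by (intro exI[of _ "\<lambda>t. (\<gamma> t, \<eta> t)"]) blast
qed

lemma has_endpoint_differential_carnot_prod:
  assumes G: "lie_group G" and H: "lie_group H"
    and S: "has_endpoint_differential G c (\<lambda>t. fst (u t)) S"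
    and T: "has_endpoint_differential H d (\<lambda>t. snd (u t)) T"
  shows "has_endpoint_differential (carnot_prod G H) (prod_chart c d) u
    (\<lambda>v. (S (\<lambda>t. fst (v t)), T (\<lambda>t. snd (v t))))"
proof -
  let ?C = "controls (carnot_prod G H)"
  obtain K where K: "\<And>v. v \<in> controls G \<Longrightarrow> norm (S v) \<le> K * Linf_norm v"
    using S unfolding has_endpoint_differential_def bounded_linear_on_controls_def by blast
  obtain K' where K': "\<And>v. v \<in> controls H \<Longrightarrow> norm (T v) \<le> K' * Linf_norm v"
    using T unfolding has_endpoint_differential_def bounded_linear_on_controls_def by blast
  \<comment> \<open>The bounds \<open>K\<close> and \<open>K'\<close> may be negative; absolute
    values make it legitimate to enlarge the component norms to \<open>Linf_norm v\<close>.\<close>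
  have bd: "norm (S (\<lambda>t. fst (v t)), T (\<lambda>t. snd (v t))) \<le> (\<bar>K\<bar> + \<bar>K'\<bar>) * Linf_norm v" if "v \<in> ?C" for v
  proof -
    note L = Linf_norm_fst_snd_le[OF that]
    have "norm (S (\<lambda>t. fst (v t))) \<le> K * Linf_norm (\<lambda>t. fst (v t))"
      "norm (T (\<lambda>t. snd (v t))) \<le> K' * Linf_norm (\<lambda>t. snd (v t))"
      using that K K' by (simp_all add: controls_carnot_prod_iff)
    moreover have "K * Linf_norm (\<lambda>t. fst (v t)) \<le> \<bar>K\<bar> * Linf_norm v" 
      "K' * Linf_norm (\<lambda>t. snd (v t)) \<le> \<bar>K'\<bar> * Linf_norm v"
      by (intro mult_mono L abs_ge_self abs_ge_zero Linf_norm_nonneg)+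
    ultimately show ?thesis
      using norm_Pair_le[of "S (\<lambda>t. fst (v t))" "T (\<lambda>t. snd (v t))"] by (simp add: algebra_simps)
  qed
  have lin: "bounded_linear_on_controls (carnot_prod G H) (\<lambda>v. (S (\<lambda>t. fst (v t)), T (\<lambda>t. snd (v t))))"
    unfolding bounded_linear_on_controls_def
  proof (intro conjI)
    show "\<exists>K. \<forall>v\<in>?C. norm (S (\<lambda>t. fst (v t)), T (\<lambda>t. snd (v t))) \<le> K * Linf_norm v"
      using bd by blast
  qed (use S T in \<open>simp_all add: has_endpoint_differential_def bounded_linear_on_controls_def
      controls_carnot_prod_iff\<close>)
  obtain E where E: "endpoint_map G E" "E (\<lambda>t. fst (u t)) \<in> cdom c" and
    Ed: "\<And>\<epsilon>. \<epsilon> > 0 \<Longrightarrow> \<exists>\<delta>>0. \<forall>v\<in>controls G. Linf_norm v < \<delta> \<longrightarrow>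
          E (\<lambda>t. fst (u t) + v t) \<in> cdom c \<and>
          norm (cmap c (E (\<lambda>t. fst (u t) + v t)) - cmap c (E (\<lambda>t. fst (u t))) - S v) \<le> \<epsilon> * Linf_norm v"
    using S unfolding has_endpoint_differential_def by blast
  obtain F where F: "endpoint_map H F" "F (\<lambda>t. snd (u t)) \<in> cdom d" and
    Fd: "\<And>\<epsilon>. \<epsilon> > 0 \<Longrightarrow> \<exists>\<delta>>0. \<forall>v\<in>controls H. Linf_norm v < \<delta> \<longrightarrow>
          F (\<lambda>t. snd (u t) + v t) \<in> cdom d \<and>
          norm (cmap d (F (\<lambda>t. snd (u t) + v t)) - cmap d (F (\<lambda>t. snd (u t))) - T v) \<le> \<epsilon> * Linf_norm v"
    using T unfolding has_endpoint_differential_def by blast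
  let ?E = "\<lambda>h. (E (\<lambda>t. fst (h t)), F (\<lambda>t. snd (h t)))"
  have "\<exists>\<delta>>0. \<forall>v\<in>?C. Linf_norm v < \<delta> \<longrightarrow>
          ?E (\<lambda>t. u t + v t) \<in> cdom (prod_chart c d) \<and>
          norm (cmap (prod_chart c d) (?E (\<lambda>t. u t + v t)) - cmap (prod_chart c d) (?E u) -
            (S (\<lambda>t. fst (v t)), T (\<lambda>t. snd (v t)))) \<le> \<epsilon> * Linf_norm v" if "\<epsilon> > 0" for \<epsilon>
  proof -
    \<comment> \<open>The norm of a pair is at most the sum of the component norms, so each factor
      gets half of the error.\<close>
    have e2: "\<epsilon> / 2 > 0" using that by simp
    obtain \<delta>1 where \<delta>1: "\<delta>1 > 0" "\<And>v. v \<in> controls G \<Longrightarrow> Linf_norm v < \<delta>1 \<Longrightarrow>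
          E (\<lambda>t. fst (u t) + v t) \<in> cdom c \<and>
          norm (cmap c (E (\<lambda>t. fst (u t) + v t)) - cmap c (E (\<lambda>t. fst (u t))) - S v) \<le> \<epsilon> / 2 * Linf_norm v"
      using Ed[OF e2] by blast
    obtain \<delta>2 where \<delta>2: "\<delta>2 > 0" "\<And>v. v \<in> controls H \<Longrightarrow> Linf_norm v < \<delta>2 \<Longrightarrow>
          F (\<lambda>t. snd (u t) + v t) \<in> cdom d \<and>
          norm (cmap d (F (\<lambda>t. snd (u t) + v t)) - cmap d (F (\<lambda>t. snd (u t))) - T v) \<le> \<epsilon> / 2 * Linf_norm v"
      using Fd[OF e2] by blast
    show ?thesis
    proof (intro exI[of _ "min \<delta>1 \<delta>2"] conjI ballI impI)
      fix v assume v: "v \<in> ?C" "Linf_norm v < min \<delta>1 \<delta>2"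
      note L = Linf_norm_fst_snd_le[OF v(1)]
      have v': "(\<lambda>t. fst (v t)) \<in> controls G" "(\<lambda>t. snd (v t)) \<in> controls H"
        using v by (simp_all add: controls_carnot_prod_iff)
      have lt: "Linf_norm (\<lambda>t. fst (v t)) < \<delta>1" "Linf_norm (\<lambda>t. snd (v t)) < \<delta>2"
        using v L by auto
      let ?x = "cmap c (E (\<lambda>t. fst (u t) + fst (v t))) - cmap c (E (\<lambda>t. fst (u t))) - S (\<lambda>t. fst (v t))"
      let ?y = "cmap d (F (\<lambda>t. snd (u t) + snd (v t))) - cmap d (F (\<lambda>t. snd (u t))) - T (\<lambda>t. snd (v t))"
      show "?E (\<lambda>t. u t + v t) \<in> cdom (prod_chart c d)"
        using \<delta>1(2)[OF v'(1) lt(1)] \<delta>2(2)[OF v'(2) lt(2)] by simp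
      have "norm ?x \<le> \<epsilon> / 2 * Linf_norm (\<lambda>t. fst (v t))" "norm ?y \<le> \<epsilon> / 2 * Linf_norm (\<lambda>t. snd (v t))"
        using \<delta>1(2)[OF v'(1) lt(1)] \<delta>2(2)[OF v'(2) lt(2)] by simp_all
      moreover have "\<epsilon> / 2 * Linf_norm (\<lambda>t. fst (v t)) \<le> \<epsilon> / 2 * Linf_norm v"
        "\<epsilon> / 2 * Linf_norm (\<lambda>t. snd (v t)) \<le> \<epsilon> / 2 * Linf_norm v"
        using e2 L by (intro mult_left_mono; simp)+
      ultimately have "norm (?x, ?y) \<le> \<epsilon> * Linf_norm v"
        using norm_Pair_le[of ?x ?y] by simp
      then show "norm (cmap (prod_chart c d) (?E (\<lambda>t. u t + v t)) - cmap (prod_chart c d) (?E u) -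
            (S (\<lambda>t. fst (v t)), T (\<lambda>t. snd (v t)))) \<le> \<epsilon> * Linf_norm v"
        by simp
    qed (use \<delta>1 \<delta>2 in simp)
  qed
  then show ?thesis
    unfolding has_endpoint_differential_def
    using lin endpoint_map_carnot_prod[OF G H E(1) F(1)] E(2) F(2)
    by (intro conjI exI[of _ ?E]) auto
qed

section \<open>Non-abnormal curves and directions in the product\<close>

lemma non_abnormal_curve_Pair:
  assumes G: "lie_group G" and H: "lie_group H"
    and \<gamma>: "non_abnormal_curve G \<gamma>" and \<eta>: "non_abnormal_curve H \<eta>"
  shows "non_abnormal_curve (carnot_prod G H) (\<lambda>t. (\<gamma> t, \<eta> t))"
proof -
  obtain h c S where h: "h \<in> controls G" "has_control G \<gamma> h" "c \<in> atlas G"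
    "has_endpoint_differential G c h S" "S ` controls G = UNIV"
    using \<gamma> unfolding non_abnormal_curve_def by blast
  obtain k d T where k: "k \<in> controls H" "has_control H \<eta> k" "d \<in> atlas H"
    "has_endpoint_differential H d k T" "T ` controls H = UNIV"
    using \<eta> unfolding non_abnormal_curve_def by blast
  let ?D = "\<lambda>v. (S (\<lambda>t. fst (v t)), T (\<lambda>t. snd (v t)))"
  \<comment> \<open>Horizontal controls of the two factors can be prescribed independently, so
    preimages of \<open>x\<close> and \<open>y\<close> combine into one of the pair.\<close>
  have "(x, y) \<in> ?D ` controls (carnot_prod G H)" for x y
  proof -
    obtain v where "v \<in> controls G" "x = S v"
      using h(5) by blast
    moreover obtain w where "w \<in> controls H" "y = T w"
      using k(5) by blast
    ultimately show ?thesis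
      by (intro image_eqI[of _ _ "\<lambda>t. (v t, w t)"]) (auto simp: controls_carnot_prod_iff)
  qed
  then have "?D ` controls (carnot_prod G H) = UNIV" by auto
  moreover have "has_endpoint_differential (carnot_prod G H) (prod_chart c d) (\<lambda>t. (h t, k t)) ?D"
    using has_endpoint_differential_carnot_prod[OF G H, of c "\<lambda>t. (h t, k t)" S d T] h k by simp
  moreover have "(\<lambda>t. (h t, k t)) \<in> controls (carnot_prod G H)"
    using h k by (simp add: controls_carnot_prod_iff)
  moreover have "has_control (carnot_prod G H) (\<lambda>t. (\<gamma> t, \<eta> t)) (\<lambda>t. (h t, k t))"
    using h k by (simp add: has_control_carnot_prod_iff[OF G H])
  moreover have "prod_chart c d \<in> atlas (carnot_prod G H)"
    using h k by (simp add: prod_atlasI)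
  ultimately show ?thesis
    unfolding non_abnormal_curve_def by blast
qed

lemma one_parameter_subgroup_Pair:
  assumes "one_parameter_subgroup G X \<sigma>" "one_parameter_subgroup H Y \<tau>"
  shows "one_parameter_subgroup (carnot_prod G H) (X, Y) (\<lambda>t. (\<sigma> t, \<tau> t))"
  using assms unfolding one_parameter_subgroup_def
  by (auto intro: continuous_on_Pair has_vector_derivative_Pair)

text \<open>Neither component could be replaced by \<open>0\<close> in general: at the zero control
  the differential of an end-point map reaches only the horizontal layer.\<close>

lemma non_abnormal_direction_Pair:
  assumes "lie_group G" "lie_group H" "non_abnormal_direction G X" "non_abnormal_direction H Y"
  shows "non_abnormal_direction (carnot_prod G H) (X, Y)"
  using assms unfolding non_abnormal_direction_def
  by (auto simp: zero_prod_def intro: one_parameter_subgroup_Pair non_abnormal_curve_Pair)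

theorem proposition5p13:
  fixes G1 :: "('g1::{t2_space, second_countable_topology, group_add}, 'e1::euclidean_space)
                 stratified_group"
    and G2 :: "('g2::{t2_space, second_countable_topology, group_add}, 'e2::euclidean_space)
                 stratified_group"
  assumes "carnot_group G1"
    and "carnot_group G2"
    and "\<exists>X. non_abnormal_direction G1 X"
    and "\<exists>X. non_abnormal_direction G2 X"
  shows "carnot_group (carnot_prod G1 G2) \<and>
    (\<exists>X. non_abnormal_direction (carnot_prod G1 G2) X)"
proof
  show "carnot_group (carnot_prod G1 G2)"
    using assms(1,2) by (rule carnot_group_carnot_prod)
  show "\<exists>X. non_abnormal_direction (carnot_prod G1 G2) X"
    using assms by (auto simp: carnot_group_def intro: non_abnormal_direction_Pair)
qed

end
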